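(* Let $G_1$ and $G_2$ be infinite, connected, locally finite graphs (possibly equal) on each of which simple random walk is recurrent, and let $o_1\in G_1$ and $o_2\in G_2$ be vertices. Let $X,X'$ be two independent simple random walks on $G_1$ started at $o_1$, and let $\mu$ be the law on $\{0,1\}^{\mathbb{N}}$ of the sequence $\xi(t)=\mathbf{1}\{X(t)=o_1 \text{ or } X'(t)=o_1\}$. Let $W$ be a simple random walk on $G_2$ started at $o_2$, and let $\nu$ be the law on $\{0,1\}^{\mathbb{N}}$ of the sequence $\eta(t)=\mathbf{1}\{W(t)=o_2\}$. Then $\mu$ is not absolutely continuous with respect to $\nu$.
   Context: Simple random walk in discrete time on a locally finite graph moves at each step to a uniformly chosen neighbour of its current vertex. The graph is recurrent if the walk returns to its starting vertex almost surely. The return times of a collection of walkers are the set of times at which at least one of them is at the common starting vertex, encoded as a $\{0,1\}$-valued sequence; laws are taken on $\{0,1\}^{\mathbb{N}}$ with the product $\sigma$-algebra. *)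

theory Defs
  imports "HOL-Probability.Probability"
begin

text \<open>A simple undirected graph with vertex set \<open>V\<close>; the edge relation \<open>E\<close> contains both
  orientations of each edge, so the neighbours of \<open>v\<close> are \<open>E `` {v}\<close>.\<close>

definition simple_graph :: "'a set \<Rightarrow> ('a \<times> 'a) set \<Rightarrow> bool" where
  "simple_graph V E \<longleftrightarrow> E \<subseteq> V \<times> V \<and> sym E \<and> irrefl E"

definition connected_graph :: "'a set \<Rightarrow> ('a \<times> 'a) set \<Rightarrow> bool" where
  "connected_graph V E \<longleftrightarrow> (\<forall>u\<in>V. \<forall>v\<in>V. (u, v) \<in> E\<^sup>*)"

definition locally_finite_graph :: "'a set \<Rightarrow> ('a \<times> 'a) set \<Rightarrow> bool" where
  "locally_finite_graph V E \<longleftrightarrow> (\<forall>v\<in>V. finite (E `` {v}))"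

text \<open>\<open>pmf_of_set\<close> is only meaningful for finite nonempty sets, so the next definition is
  intended for locally finite graphs without isolated vertices. Infinite connected locally
  finite graphs are of this kind.\<close>

definition simple_random_walk ::
    "'a set \<Rightarrow> ('a \<times> 'a) set \<Rightarrow> 'a \<Rightarrow> 'w measure \<Rightarrow> (nat \<Rightarrow> 'w \<Rightarrow> 'a) \<Rightarrow> bool" where
  "simple_random_walk V E v M X \<longleftrightarrow>
     prob_space M \<and>
     (\<forall>t. X t \<in> measurable M (count_space V)) \<and>
     (AE \<omega> in M. X 0 \<omega> = v) \<and>
     (\<forall>n x y. \<P>(\<omega> in M. \<forall>i\<le>n. X i \<omega> = x i) > 0 \<longrightarrow>
        \<P>(\<omega> in M. X (Suc n) \<omega> = y \<bar> \<forall>i\<le>n. X i \<omega> = x i) = pmf (pmf_of_set (E `` {x n})) y)"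

text \<open>A definition cannot quantify over all types of sample spaces, so recurrence is stated for
  coordinate processes on path space. The lemma below extends it to walks on arbitrary
  probability spaces.\<close>

definition recurrent_graph :: "'a set \<Rightarrow> ('a \<times> 'a) set \<Rightarrow> bool" where
  "recurrent_graph V E \<longleftrightarrow>
     (\<forall>v\<in>V. \<forall>P :: (nat \<Rightarrow> 'a) measure.
        simple_random_walk V E v P (\<lambda>t \<omega>. \<omega> t) \<longrightarrow> (AE \<omega> in P. \<exists>t>0. \<omega> t = v))"

abbreviation seq_space :: "'a set \<Rightarrow> (nat \<Rightarrow> 'a) measure" where
  "seq_space V \<equiv> \<Pi>\<^sub>M t\<in>UNIV. count_space V"

lemma recurrent_graph_returns:
  fixes X :: "nat \<Rightarrow> 'w \<Rightarrow> 'a"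
  assumes rec: "recurrent_graph V E" and v: "v \<in> V"
    and X: "simple_random_walk V E v M X"
  shows "AE \<omega> in M. \<exists>t>0. X t \<omega> = v"
proof -
  define f where "f = (\<lambda>\<omega> t. X t \<omega>)"
  define P where "P = distr M (seq_space V) f"
  interpret prob_space M
    using X by (simp add: simple_random_walk_def)
  have mX: "X t \<in> measurable M (count_space V)" for t
    using X by (simp add: simple_random_walk_def)
  have f: "f \<in> measurable M (seq_space V)"
    unfolding f_def by (intro measurable_PiM_single') (auto simp: mX dest: measurable_space[OF mX])
  have coord: "(\<lambda>\<omega>. \<omega> t) \<in> measurable (seq_space V) (count_space V)" for t
    by (intro measurable_component_singleton) simp
  have ev: "{\<omega> \<in> space (seq_space V). \<omega> t = z} \<in> sets (seq_space V)" for t z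
  proof -
    have "{\<omega> \<in> space (seq_space V). \<omega> t = z} = (\<lambda>\<omega>. \<omega> t) -` ({z} \<inter> V) \<inter> space (seq_space V)"
      by (auto simp: space_PiM)
    also have "\<dots> \<in> sets (seq_space V)"
      by (intro measurable_sets[OF coord]) auto
    finally show ?thesis .
  qed
  have ev': "{\<omega> \<in> space (seq_space V). \<forall>i\<le>n. \<omega> i = x i} \<in> sets (seq_space V)" for n :: nat and x
    by (rule sets.sets_Collect_countable_All) (use ev in \<open>auto intro!: sets.sets_Collect_imp sets.sets_Collect_const\<close>)
  have tr: "measure P {\<omega> \<in> space P. Q \<omega>} = measure M {\<omega> \<in> space M. Q (f \<omega>)}"
    if "{\<omega> \<in> space (seq_space V). Q \<omega>} \<in> sets (seq_space V)" for Q
  proof -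
    have "f -` {\<omega> \<in> space (seq_space V). Q \<omega>} \<inter> space M = {\<omega> \<in> space M. Q (f \<omega>)}"
      using measurable_space[OF f] by auto
    then show ?thesis
      unfolding P_def using measure_distr[OF f that] by simp
  qed
  have hist: "measure P {\<omega> \<in> space P. \<forall>i\<le>n. \<omega> i = x i}
      = measure M {\<omega> \<in> space M. \<forall>i\<le>n. X i \<omega> = x i}" for n x
    using tr[OF ev'] by (simp add: f_def)
  have nxt: "measure P {\<omega> \<in> space P. \<omega> (Suc n) = y \<and> (\<forall>i\<le>n. \<omega> i = x i)}
      = measure M {\<omega> \<in> space M. X (Suc n) \<omega> = y \<and> (\<forall>i\<le>n. X i \<omega> = x i)}" for n x y
    using tr[of "\<lambda>\<omega>. \<omega> (Suc n) = y \<and> (\<forall>i\<le>n. \<omega> i = x i)",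
        OF sets.sets_Collect_conj[OF ev' ev]]
    by (simp add: f_def)
  have "simple_random_walk V E v P (\<lambda>t \<omega>. \<omega> t)"
    unfolding simple_random_walk_def
  proof (intro conjI allI impI)
    show "prob_space P"
      unfolding P_def by (rule prob_space_distr[OF f])
    show "(\<lambda>\<omega>. \<omega> t) \<in> measurable P (count_space V)" for t
      unfolding P_def using coord by simp
    show "AE \<omega> in P. \<omega> 0 = v"
      unfolding P_def using X by (subst AE_distr_iff[OF f ev]) (simp add: f_def simple_random_walk_def)
    show "\<P>(\<omega> in P. \<omega> (Suc n) = y \<bar> \<forall>i\<le>n. \<omega> i = x i) = pmf (pmf_of_set (E `` {x n})) y"
      if "0 < \<P>(\<omega> in P. \<forall>i\<le>n. \<omega> i = x i)" for n x y
      using that X unfolding cond_prob_def hist nxt simple_random_walk_def by blast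
  qed
  then have "AE \<omega> in P. \<exists>t>0. \<omega> t = v"
    using rec v by (simp add: recurrent_graph_def)
  then show ?thesis
    unfolding P_def using AE_distrD[OF f] by (simp add: f_def)
qed

end

theory Submission
  imports Defs
begin

text \<open>
  The returns of a recurrent walk form a renewal process, and on an infinite graph the return
  probabilities \<open>u t\<close> tend to \<open>0\<close>: the energy \<open>\<Sum>x. deg x (p\<^sub>n(x) / deg x)\<^sup>2\<close> decreases, so
  \<open>p\<^sub>n(o) / deg o\<close> and \<open>p\<^sub>n\<^sub>+\<^sub>d(x) / deg x\<close> become equal on spheres of unbounded cardinality.
  Suppose that \<open>\<mu>\<close> is absolutely continuous with respect to \<open>\<nu>\<close>. Events \<open>A\<^sub>i\<close> with
  \<open>\<nu>(A\<^sub>i \<inter> B) - \<nu>(A\<^sub>i) \<nu>(B) \<longlonglongrightarrow> 0\<close> for every cylinder \<open>B\<close> then satisfy \<open>\<mu>(A\<^sub>i) - \<nu>(A\<^sub>i) \<longlonglongrightarrow> 0\<close>.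

  Take first the event that the sequence has a one \<open>k\<close> steps after its \<open>i\<close>-th one. Under \<open>\<nu>\<close> its
  probability is the return probability of \<open>W\<close> at time \<open>k\<close>. Under \<open>\<mu>\<close> it is, on average over \<open>i\<close>,
  close to that of \<open>X\<close>, because the other walker rarely sits at the origin \<open>k\<close> steps later.
  Hence \<open>X\<close>, \<open>X'\<close> and \<open>W\<close> have the same return probabilities, and so the same renewal law.

  Then take the event of at least \<open>m\<close> ones up to a time \<open>T\<^sub>m\<close> chosen so that its \<open>\<nu>\<close>-probability \<open>p\<close>
  lies in \<open>[1/4, 1/2]\<close>. It mixes, as restarting the sequence after a fixed number of ones hardly
  changes it, yet its \<open>\<mu>\<close>-probability is at least \<open>1 - (1 - p)\<^sup>2\<close>, since either walker alone may
  produce the \<open>m\<close> ones.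
\<close>

section \<open>Decay of the heat kernel on an infinite graph\<close>

text \<open>\<open>a (Suc n) x\<close> is the mean of \<open>a n\<close> over the neighbours of
  \<open>x\<close>. By the variance identity the energy lost in one step is therefore exactly the
  sum of the squared differences over all oriented edges, and the left side is one term of that
  sum.\<close>

lemma heat_kernel_energy:
  fixes q :: "nat \<Rightarrow> 'a \<Rightarrow> real" and E :: "('a \<times> 'a) set" and V
  defines "a \<equiv> \<lambda>n x. q n x / real (card (E `` {x}))"
  defines "L \<equiv> \<lambda>n. \<Sum>x | q n x \<noteq> 0. real (card (E `` {x})) * (a n x)\<^sup>2"
  assumes E: "E \<subseteq> V \<times> V" "sym E"
    and fin: "\<And>x. x \<in> V \<Longrightarrow> finite (E `` {x})"
    and supp: "\<And>n. finite {x. q n x \<noteq> 0}" "\<And>n x. q n x \<noteq> 0 \<Longrightarrow> x \<in> V"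
    and step: "\<And>n x. x \<in> V \<Longrightarrow> q (Suc n) x = (\<Sum>y\<in>E `` {x}. a n y)"
    and e: "(x0, y0) \<in> E"
  shows "(a n y0 - a (Suc n) x0)\<^sup>2 \<le> L n - L (Suc n)"
proof -
  define S where "S n = {x. q n x \<noteq> 0}" for n
  \<comment> \<open>Finite, and large enough for both energies: it holds the support at time
    \<open>Suc n\<close> and all neighbours of the support at time \<open>n\<close>. Adding
    \<open>x0\<close> makes sure that the edge to be estimated is counted.\<close>
  define N where "N = insert x0 (S (Suc n) \<union> E `` S n)"
  have SV: "S n \<subseteq> V" for n using supp(2) by (auto simp: S_def)
  have NV: "N \<subseteq> V" using E e SV by (auto simp: N_def)
  have finS: "finite (S n)" for n using supp(1) by (simp add: S_def)
  have "finite (E `` S n)"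
    using finS SV fin by (subst Image_eq_UN) blast
  then have finN: "finite N" using finS by (simp add: N_def)
  have a0: "a n x = 0" if "x \<notin> S n" for n x using that by (simp add: a_def S_def)
  have symE: "(x, y) \<in> E \<longleftrightarrow> (y, x) \<in> E" for x y using E(2) by (auto dest: symD)
  have deg: "real (card (E `` {x})) * a (Suc n) x = (\<Sum>y\<in>E `` {x}. a n y)" if "x \<in> V" for x
  proof (cases "E `` {x} = {}")
    case False
    then have "card (E `` {x}) > 0" using fin[OF that] by (simp add: card_gt_0_iff)
    then show ?thesis using step[OF that] by (simp add: a_def)
  qed simp
  \<comment> \<open>Edges are now counted from their other end: by symmetry of \<open>E\<close>, a
    support point \<open>y\<close> occurs once for each of its neighbours, and all of these lie in
    \<open>N\<close>.\<close>
  have "(\<Sum>x\<in>N. \<Sum>y\<in>E `` {x}. (a n y)\<^sup>2) = (\<Sum>x\<in>N. \<Sum>y\<in>S n. of_bool ((x, y) \<in> E) * (a n y)\<^sup>2)"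
  proof (rule sum.cong[OF refl])
    fix x assume "x \<in> N"
    then have f: "finite (E `` {x})" using NV fin by auto
    have "(\<Sum>y\<in>E `` {x}. (a n y)\<^sup>2) = (\<Sum>y\<in>E `` {x} \<inter> S n. (a n y)\<^sup>2)"
      using f a0 by (intro sum.mono_neutral_right) auto
    also have "\<dots> = (\<Sum>y\<in>S n. of_bool ((x, y) \<in> E) * (a n y)\<^sup>2)"
      using finS by (intro sum.mono_neutral_cong_left) auto
    finally show "(\<Sum>y\<in>E `` {x}. (a n y)\<^sup>2) = (\<Sum>y\<in>S n. of_bool ((x, y) \<in> E) * (a n y)\<^sup>2)" .
  qed
  also have "\<dots> = (\<Sum>y\<in>S n. \<Sum>x\<in>N. of_bool ((x, y) \<in> E) * (a n y)\<^sup>2)"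
    by (rule sum.swap)
  also have "\<dots> = L n"
    unfolding L_def S_def[symmetric]
  proof (intro sum.cong refl)
    fix y assume y: "y \<in> S n"
    have "x \<in> E `` {y} \<longleftrightarrow> x \<in> N \<and> (x, y) \<in> E" for x
      using y symE[of x y] unfolding N_def by blast
    then have "E `` {y} = {x\<in>N. (x, y) \<in> E}" by blast
    then have "(\<Sum>x\<in>N. of_bool ((x, y) \<in> E) * (a n y)\<^sup>2) = (\<Sum>x\<in>E `` {y}. (a n y)\<^sup>2)"
      using sum.inter_filter[OF finN, of "\<lambda>_. (a n y)\<^sup>2" "\<lambda>x. (x, y) \<in> E"]
      by (simp add: of_bool_def if_distrib[of "\<lambda>c. c * _"] cong: if_cong)
    then show "(\<Sum>x\<in>N. of_bool ((x, y) \<in> E) * (a n y)\<^sup>2) = real (card (E `` {y})) * (a n y)\<^sup>2"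
      by simp
  qed
  finally have L1: "(\<Sum>x\<in>N. \<Sum>y\<in>E `` {x}. (a n y)\<^sup>2) = L n" .
  have L2: "L (Suc n) = (\<Sum>x\<in>N. real (card (E `` {x})) * (a (Suc n) x)\<^sup>2)"
    unfolding L_def S_def[symmetric] using finN a0
    by (intro sum.mono_neutral_left) (auto simp: N_def)
  have "(\<Sum>x\<in>N. \<Sum>y\<in>E `` {x}. (a n y - a (Suc n) x)\<^sup>2) =
    (\<Sum>x\<in>N. (\<Sum>y\<in>E `` {x}. (a n y)\<^sup>2) - real (card (E `` {x})) * (a (Suc n) x)\<^sup>2)"
  proof (intro sum.cong refl)
    fix x assume "x \<in> N"
    then have x: "x \<in> V" using NV by auto
    have "(\<Sum>y\<in>E `` {x}. (a n y - a (Suc n) x)\<^sup>2) =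
      (\<Sum>y\<in>E `` {x}. (a n y)\<^sup>2 + (a (Suc n) x)\<^sup>2 - 2 * a (Suc n) x * a n y)"
      by (intro sum.cong refl) (simp add: power2_diff algebra_simps)
    also have "\<dots> = (\<Sum>y\<in>E `` {x}. (a n y)\<^sup>2) + real (card (E `` {x})) * (a (Suc n) x)\<^sup>2
        - 2 * a (Suc n) x * (\<Sum>y\<in>E `` {x}. a n y)"
      by (simp add: sum.distrib sum_subtractf sum_distrib_left)
    also have "\<dots> = (\<Sum>y\<in>E `` {x}. (a n y)\<^sup>2) - real (card (E `` {x})) * (a (Suc n) x)\<^sup>2"
      unfolding deg[OF x, symmetric] by (simp only: power2_eq_square) algebra
    finally show "(\<Sum>y\<in>E `` {x}. (a n y - a (Suc n) x)\<^sup>2) =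
        (\<Sum>y\<in>E `` {x}. (a n y)\<^sup>2) - real (card (E `` {x})) * (a (Suc n) x)\<^sup>2" .
  qed
  also have "\<dots> = L n - L (Suc n)"
    by (simp add: sum_subtractf L1 L2)
  finally have tot: "(\<Sum>x\<in>N. \<Sum>y\<in>E `` {x}. (a n y - a (Suc n) x)\<^sup>2) = L n - L (Suc n)" .
  have x0: "x0 \<in> V" "x0 \<in> N" using e E by (auto simp: N_def)
  have "(a n y0 - a (Suc n) x0)\<^sup>2 \<le> (\<Sum>y\<in>E `` {x0}. (a n y - a (Suc n) x0)\<^sup>2)"
    using e fin[OF x0(1)] by (intro member_le_sum[where f="\<lambda>y. (a n y - a (Suc n) x0)\<^sup>2"]) auto
  also have "\<dots> \<le> (\<Sum>x\<in>N. \<Sum>y\<in>E `` {x}. (a n y - a (Suc n) x)\<^sup>2)"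
    using finN x0 by (intro member_le_sum[where f="\<lambda>x. \<Sum>y\<in>E `` {x}. (a n y - a (Suc n) x)\<^sup>2"]) (auto intro: sum_nonneg)
  finally show ?thesis using tot by simp
qed

lemma connected_graph_nbrs_nonempty:
  assumes "connected_graph V E" "infinite V" "a \<in> V" shows "E `` {a} \<noteq> {}"
proof -
  have "infinite (V - {a})" using assms by simp
  then obtain b where "b \<in> V" "b \<noteq> a" by (metis DiffE finite.emptyI ex_in_conv singletonI)
  then have "(a, b) \<in> E\<^sup>*" using assms by (auto simp: connected_graph_def)
  then show ?thesis using \<open>b \<noteq> a\<close> by (blast elim: converse_rtranclE)
qed

text \<open>Going to and fro along an edge lengthens a walk by 2, so the sets of endpoints of walks
  from \<open>v\<close> of length exactly \<open>d\<close> increase along each parity of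
  \<open>d\<close>. Together they cover the infinite set \<open>V\<close>, so for one parity the
  union is infinite, and any finite part of an increasing union already lies in one of its
  members.\<close>

lemma large_spheres:
  assumes E: "simple_graph V E" and inf: "infinite V" and con: "connected_graph V E" and v: "v \<in> V"
  shows "\<exists>d S. finite S \<and> card S = K \<and> S \<subseteq> (E ^^ d) `` {v}"
proof -
  have EV: "E \<subseteq> V \<times> V" and symE: "sym E" using E by (auto simp: simple_graph_def)
  have mono2: "(v, y) \<in> E ^^ (d + 2)" if "(v, y) \<in> E ^^ d" for y d
  proof -
    have "\<exists>z. (y, z) \<in> E"
    proof -
      have yV: "y \<in> V" using that EV v by (cases d) auto
      show ?thesis using connected_graph_nbrs_nonempty[OF con inf yV] by blast
    qed
    then obtain z where "(y, z) \<in> E" "(z, y) \<in> E" using symE by (auto dest: symD)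
    then show ?thesis using that by (auto simp: numeral_2_eq_2)
  qed
  have mono: "(v, y) \<in> E ^^ (d + 2 * j)" if "(v, y) \<in> E ^^ d" for y d j
  proof (induction j)
    case (Suc j)
    then show ?case using mono2[of y "d + 2 * j"] by (simp add: add.commute add.left_commute)
  qed (use that in simp)
  have "V \<subseteq> (\<Union>r\<in>{0, 1}. \<Union>d. (E ^^ (r + 2 * d)) `` {v})"
  proof
    fix x assume "x \<in> V"
    then have "(v, x) \<in> E\<^sup>*" using con v by (auto simp: connected_graph_def)
    then obtain d where d: "(v, x) \<in> E ^^ d" using rtrancl_power by blast
    have "d = d mod 2 + 2 * (d div 2)" "d mod 2 \<in> {0, 1}" by auto
    then show "x \<in> (\<Union>r\<in>{0, 1}. \<Union>d. (E ^^ (r + 2 * d)) `` {v})" using d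
      by (metis (no_types, lifting) UN_I UNIV_I Image_singleton_iff)
  qed
  then have "infinite (\<Union>r\<in>{0, 1}. \<Union>d. (E ^^ (r + 2 * d)) `` {v})"
    using inf finite_subset by blast
  then obtain r where "infinite (\<Union>d. (E ^^ (r + 2 * d)) `` {v})"
    by (simp only: finite_UN finite.intros) blast
  then obtain S where S: "finite S" "card S = K" "S \<subseteq> (\<Union>d. (E ^^ (r + 2 * d)) `` {v})"
    using infinite_arbitrarily_large by blast
  then have "\<forall>x\<in>S. \<exists>d. (v, x) \<in> E ^^ (r + 2 * d)" by auto
  then obtain f where f: "\<And>x. x \<in> S \<Longrightarrow> (v, x) \<in> E ^^ (r + 2 * f x)" by metis
  define D where "D = Max (insert 0 (f ` S))"
  have "S \<subseteq> (E ^^ (r + 2 * D)) `` {v}"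
  proof
    fix x assume x: "x \<in> S"
    then have "f x \<le> D" using S(1) by (auto simp: D_def)
    then have "r + 2 * D = (r + 2 * f x) + 2 * (D - f x)" by simp
    then show "x \<in> (E ^^ (r + 2 * D)) `` {v}" using mono[OF f[OF x], of "D - f x"] by (metis Image_singleton_iff)
  qed
  then show ?thesis using S by blast
qed

text \<open>The energy decreases and is nonnegative, so its drops vanish, and along every edge the
  normalised masses at consecutive times become equal. Hence \<open>a n v\<close> is asymptotically
  the value of \<open>a (n + d)\<close> at each of \<open>K\<close> vertices reached by walks of
  length \<open>d\<close>. These share a total mass of at most 1, and \<open>K\<close> is
  arbitrary.\<close>

lemma heat_kernel_tendsto_0:
  fixes q :: "nat \<Rightarrow> 'a \<Rightarrow> real"
  assumes E: "simple_graph V E" and inf: "infinite V" and con: "connected_graph V E"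
    and lf: "locally_finite_graph V E" and v: "v \<in> V"
    and nonneg: "\<And>n x. q n x \<ge> 0"
    and supp: "\<And>n. finite {x. q n x \<noteq> 0}" "\<And>n x. q n x \<noteq> 0 \<Longrightarrow> x \<in> V"
    and total: "\<And>n S. finite S \<Longrightarrow> sum (q n) S \<le> 1"
    and step: "\<And>n x. x \<in> V \<Longrightarrow> q (Suc n) x = (\<Sum>y\<in>E `` {x}. q n y / real (card (E `` {y})))"
  shows "(\<lambda>n. q n v) \<longlonglongrightarrow> 0"
proof -
  have EV: "E \<subseteq> V \<times> V" and symE: "sym E" using E by (auto simp: simple_graph_def)
  have fin: "finite (E `` {x})" if "x \<in> V" for x using lf that by (auto simp: locally_finite_graph_def)
  define a where "a n x = q n x / real (card (E `` {x}))" for n x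
  define L where "L n = (\<Sum>x | q n x \<noteq> 0. real (card (E `` {x})) * (a n x)\<^sup>2)" for n
  have en: "(a n y - a (Suc n) x)\<^sup>2 \<le> L n - L (Suc n)" if "(x, y) \<in> E" for n x y
    unfolding L_def a_def
    using heat_kernel_energy[where q = q and E = E and V = V and n = n] EV symE fin supp step that by blast
  have an: "a n x \<ge> 0" for n x using nonneg by (simp add: a_def)
  have aq: "a n x \<le> q n x" for n x
  proof (cases "card (E `` {x}) = 0")
    case False
    then have "real (card (E `` {x})) \<ge> 1" by simp
    then show ?thesis using nonneg[of n x] unfolding a_def
      by (metis div_by_1 frac_le order_refl zero_less_one)
  qed (simp add: a_def nonneg)
  have Ln: "L n \<ge> 0" for n unfolding L_def by (intro sum_nonneg) auto
  have lim1: "(\<lambda>n. a n y - a (Suc n) x) \<longlonglongrightarrow> 0" if "(x, y) \<in> E" for x y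
  proof -
    have "L (Suc n) \<le> L n" for n using en[OF that, of n] by (smt (verit) zero_le_power2)
    then have "decseq L" by (rule decseq_SucI)
    then obtain l where l: "L \<longlonglongrightarrow> l" using decseq_convergent[of L 0] Ln by blast
    then have "(\<lambda>n. L n - L (Suc n)) \<longlonglongrightarrow> 0" using tendsto_diff[OF l LIMSEQ_Suc[OF l]] by simp
    then have "(\<lambda>n. (a n y - a (Suc n) x)\<^sup>2) \<longlonglongrightarrow> 0"
      by (rule tendsto_sandwich[OF _ _ tendsto_const, rotated 2]) (auto simp: en that)
    then show ?thesis using tendsto_real_sqrt[of "\<lambda>n. (a n y - a (Suc n) x)\<^sup>2" 0]
      by (simp add: tendsto_rabs_zero_iff)
  qed
  have lim2: "(\<lambda>n. a n v - a (n + d) x) \<longlonglongrightarrow> 0" if "(v, x) \<in> E ^^ d" for x d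
    using that
  proof (induction d arbitrary: x)
    case (Suc d)
    then obtain y where y: "(v, y) \<in> E ^^ d" "(y, x) \<in> E" by auto
    have "(x, y) \<in> E" using y symE by (auto dest: symD)
    from LIMSEQ_ignore_initial_segment[OF lim1[OF this], of d]
    have "(\<lambda>n. a (n + d) y - a (n + Suc d) x) \<longlonglongrightarrow> 0" by simp
    from tendsto_add[OF Suc.IH[OF y(1)] this] show ?case by simp
  qed simp
  have "(\<lambda>n. a n v) \<longlonglongrightarrow> 0"
  proof (rule LIMSEQ_I)
    fix r :: real assume r: "r > 0"
    \<comment> \<open>Below, the sum over \<open>K\<close> vertices of the differences is less than
      1 and the sum of the later masses is at most 1. So \<open>real K * a n v\<close> stays below
      2, which explains the 2 here.\<close>
    obtain K :: nat where K: "2 / r < real K" using reals_Archimedean2 by blast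
    then have K0: "K > 0" using r by (cases K) (auto simp: field_simps not_less)
    obtain d S where S: "finite S" "card S = K" "S \<subseteq> (E ^^ d) `` {v}"
      using large_spheres[OF E inf con v] by blast
    have "(\<lambda>n. \<Sum>x\<in>S. a n v - a (n + d) x) \<longlonglongrightarrow> (\<Sum>x\<in>S. 0)"
      using S lim2 by (intro tendsto_sum) auto
    then have "\<forall>\<^sub>F n in sequentially. (\<Sum>x\<in>S. a n v - a (n + d) x) < 1"
      by (rule order_tendstoD) simp
    then obtain M where M: "\<And>n. n \<ge> M \<Longrightarrow> (\<Sum>x\<in>S. a n v - a (n + d) x) < 1"
      by (auto simp: eventually_sequentially)
    show "\<exists>no. \<forall>n\<ge>no. norm (a n v - 0) < r"
    proof (intro exI[of _ M] allI impI)
      fix n assume "n \<ge> M"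
      then have "real K * a n v < 1 + (\<Sum>x\<in>S. a (n + d) x)" using M[of n] S by (simp add: sum_subtractf)
      also have "(\<Sum>x\<in>S. a (n + d) x) \<le> (\<Sum>x\<in>S. q (n + d) x)" by (intro sum_mono aq)
      also have "\<dots> \<le> 1" using total S by simp
      finally have "a n v < 2 / real K" using K0 by (simp add: field_simps)
      also have "\<dots> < r" using K K0 r by (simp add: field_simps)
      finally show "norm (a n v - 0) < r" using an by simp
    qed
  qed
  then have lim: "(\<lambda>n. real (card (E `` {v})) * a n v) \<longlonglongrightarrow> 0"
    by (rule tendsto_mult_right_zero)
  show ?thesis
  \<comment> \<open>At degree 0, division by zero makes \<open>a n v\<close> equal to 0 whatever
    \<open>q\<close> is; there \<open>step\<close> gives the limit directly.\<close>
  proof (cases "card (E `` {v}) = 0")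
    case True
    then have emp: "E `` {v} = {}" using fin v by auto
    have "q (Suc n) v = 0" for n using step[OF v] emp by simp
    then show ?thesis by (simp add: filterlim_sequentially_Suc[of "\<lambda>n. q n v", symmetric])
  next
    case False
    then show ?thesis using lim by (simp add: a_def)
  qed
qed

section \<open>Finite-horizon events and the counting of returns in binary sequences\<close>

text \<open>Finite-horizon events are kept as predicates on sequences rather than as measurable
  sets. The same \<open>Q\<close> can then be evaluated on different processes, on their union and
  on shifted sequences.\<close>

definition depends_upto :: "nat \<Rightarrow> ((nat \<Rightarrow> bool) \<Rightarrow> bool) \<Rightarrow> bool" where
  "depends_upto n Q \<longleftrightarrow> (\<forall>w w'. (\<forall>t\<le>n. w t = w' t) \<longrightarrow> Q w = Q w')"

text \<open>Time \<open>0\<close> is not counted, so that \<open>hit i t w\<close> says that the \<open>i\<close>-th return happens at time \<open>t\<close>.\<close>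

definition cnt :: "nat \<Rightarrow> (nat \<Rightarrow> bool) \<Rightarrow> nat" where
  "cnt t w = card {s \<in> {0<..t}. w s}"

definition hit :: "nat \<Rightarrow> nat \<Rightarrow> (nat \<Rightarrow> bool) \<Rightarrow> bool" where
  "hit i t w \<longleftrightarrow> w t \<and> cnt t w = i"

lemma depends_uptoI:
  assumes "\<And>w w'. (\<And>t. t \<le> n \<Longrightarrow> w t = w' t) \<Longrightarrow> Q w = Q w'"
  shows "depends_upto n Q"
  unfolding depends_upto_def by (intro allI impI assms) simp

lemma depends_uptoD:
  assumes "depends_upto n Q" "\<And>t. t \<le> n \<Longrightarrow> w t = w' t"
  shows "Q w = Q w'"
  using assms(1)[unfolded depends_upto_def, rule_format, of w w'] assms(2) by simp

lemma depends_upto_mono: "depends_upto n Q \<Longrightarrow> n \<le> m \<Longrightarrow> depends_upto m Q"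
  by (rule depends_uptoI, erule depends_uptoD) simp

lemma cnt_cong: "(\<And>s. s \<le> t \<Longrightarrow> w s = w' s) \<Longrightarrow> cnt t w = cnt t w'"
  unfolding cnt_def by (intro arg_cong[where f=card]) auto

lemma hit_cong: "(\<And>s. s \<le> t \<Longrightarrow> w s = w' s) \<Longrightarrow> hit i t w = hit i t w'"
  unfolding hit_def using cnt_cong[of t w w'] by simp

lemma depends_upto_const [simp]: "depends_upto n (\<lambda>w. c)"
  by (simp add: depends_upto_def)

lemma depends_upto_coord [simp]: "t \<le> n \<Longrightarrow> depends_upto n (\<lambda>w. w t)"
  by (rule depends_uptoI) simp

lemma depends_upto_not [simp]: "depends_upto n Q \<Longrightarrow> depends_upto n (\<lambda>w. \<not> Q w)"
  by (rule depends_uptoI, subst depends_uptoD) auto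

lemma depends_upto_conj [simp]:
  assumes "depends_upto n Q" "depends_upto n R" shows "depends_upto n (\<lambda>w. Q w \<and> R w)"
proof (rule depends_uptoI)
  fix w w' :: "nat \<Rightarrow> bool" assume "\<And>t. t \<le> n \<Longrightarrow> w t = w' t"
  then show "(Q w \<and> R w) = (Q w' \<and> R w')"
    using depends_uptoD[OF assms(1), of w w'] depends_uptoD[OF assms(2), of w w'] by simp
qed

lemma depends_upto_cnt [simp]: "t \<le> n \<Longrightarrow> depends_upto n (\<lambda>w. R (cnt t w))"
proof (rule depends_uptoI)
  fix w w' :: "nat \<Rightarrow> bool" assume "t \<le> n" "\<And>t. t \<le> n \<Longrightarrow> w t = w' t"
  then have "cnt t w = cnt t w'" by (intro cnt_cong) simp
  then show "R (cnt t w) = R (cnt t w')" by simp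
qed

lemma depends_upto_hit [simp]: "t \<le> n \<Longrightarrow> depends_upto n (hit i t)"
  by (rule depends_uptoI) (rule hit_cong, simp)

lemma depends_upto_Bex [simp]:
  assumes "\<And>i. i \<in> I \<Longrightarrow> depends_upto n (Q i)" shows "depends_upto n (\<lambda>w. \<exists>i\<in>I. Q i w)"
proof (rule depends_uptoI)
  fix w w' :: "nat \<Rightarrow> bool" assume "\<And>t. t \<le> n \<Longrightarrow> w t = w' t"
  then show "(\<exists>i\<in>I. Q i w) = (\<exists>i\<in>I. Q i w')"
    using depends_uptoD[OF assms, of _ w w'] by (intro bex_cong) auto
qed

lemma depends_upto_shift [simp]:
  "depends_upto m Q \<Longrightarrow> s + m \<le> n \<Longrightarrow> depends_upto n (\<lambda>w. Q (\<lambda>i. w (s + i)))"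
  by (rule depends_uptoI, erule depends_uptoD) simp

lemma cnt_0 [simp]: "cnt 0 w = 0"
  by (simp add: cnt_def)

lemma cnt_Suc: "cnt (Suc t) w = cnt t w + of_bool (w (Suc t))"
proof -
  have "{s \<in> {0<..Suc t}. w s} = (if w (Suc t) then insert (Suc t) {s \<in> {0<..t}. w s} else {s \<in> {0<..t}. w s})"
    by (auto simp: le_Suc_eq)
  then show ?thesis by (simp add: cnt_def)
qed

lemma cnt_add: "cnt (s + t) w = cnt s w + cnt t (\<lambda>i. w (s + i))"
  by (induction t) (auto simp: cnt_Suc)

lemma cnt_le: "cnt t w \<le> t"
  by (induction t) (auto simp: cnt_Suc)

lemma cnt_mono: "s \<le> t \<Longrightarrow> cnt s w \<le> cnt t w"
  using cnt_add[of s "t - s" w] by simp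

lemma cnt_mono_seq: "(\<And>s. w s \<Longrightarrow> z s) \<Longrightarrow> cnt t w \<le> cnt t z"
  unfolding cnt_def by (intro card_mono) auto

lemma cnt_strict: "s < t \<Longrightarrow> w t \<Longrightarrow> cnt s w < cnt t w"
  using cnt_mono[of s "t - 1" w] by (cases t) (auto simp: cnt_Suc)

lemma hit_le: "hit i t w \<Longrightarrow> i \<le> t"
  using cnt_le by (auto simp: hit_def)

lemma hit_unique: "hit i s w \<Longrightarrow> hit i t w \<Longrightarrow> s = t"
  using cnt_strict[of s t w] cnt_strict[of t s w] by (cases s t rule: linorder_cases) (auto simp: hit_def)

text \<open>The count rises by at most one per step, so it passes through every value below its
  current one. The hypothesis \<open>w 0\<close> serves the case \<open>i = 0\<close>, where the hit
  is at time 0.\<close>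

lemma le_cnt_iff_hit:
  assumes "w 0" shows "i \<le> cnt T w \<longleftrightarrow> (\<exists>t\<le>T. hit i t w)"
proof
  show "\<exists>t\<le>T. hit i t w" if "i \<le> cnt T w"
    using that
  proof (induction T)
    case 0 then show ?case using assms by (auto simp: hit_def)
  next
    case (Suc T)
    show ?case
    proof (cases "i \<le> cnt T w")
      case True then show ?thesis using Suc.IH le_SucI by blast
    next
      case False
      then have "hit i (Suc T) w" using Suc.prems by (auto simp: cnt_Suc hit_def of_bool_def split: if_splits)
      then show ?thesis by blast
    qed
  qed
  show "i \<le> cnt T w" if "\<exists>t\<le>T. hit i t w"
    using that cnt_mono by (auto simp: hit_def)
qed

text \<open>Cutting the sequence at its \<open>m\<close>-th return turns the next return into a
  first return of the shifted sequence; this is the pathwise form of the convolution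
  \<open>hit_Suc\<close>.\<close>

lemma hit_Suc_iff:
  assumes "w 0" shows "hit (Suc m) t w \<longleftrightarrow> (\<exists>s\<le>t. hit m s w \<and> hit 1 (t - s) (\<lambda>i. w (s + i)))"
proof
  assume h: "hit (Suc m) t w"
  then have "m \<le> cnt t w" by (simp add: hit_def)
  then obtain s where s: "s \<le> t" "hit m s w" using le_cnt_iff_hit[of w m t, OF assms] by blast
  then have "hit 1 (t - s) (\<lambda>i. w (s + i))" using h cnt_add[of s "t - s" w] by (simp add: hit_def)
  then show "\<exists>s\<le>t. hit m s w \<and> hit 1 (t - s) (\<lambda>i. w (s + i))" using s by blast
next
  assume "\<exists>s\<le>t. hit m s w \<and> hit 1 (t - s) (\<lambda>i. w (s + i))"
  then obtain s where "s \<le> t" "hit m s w" "hit 1 (t - s) (\<lambda>i. w (s + i))" by blast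
  then show "hit (Suc m) t w" using cnt_add[of s "t - s" w] by (simp add: hit_def)
qed

lemma measurable_cnt [measurable]:
  assumes [measurable]: "\<And>t. Measurable.pred M (w t)"
  shows "(\<lambda>\<omega>. cnt t (\<lambda>s. w s \<omega>)) \<in> measurable M (count_space UNIV)"
  by (induction t) (simp_all add: cnt_Suc)

lemma measurable_hit [measurable]:
  assumes [measurable]: "\<And>t. Measurable.pred M (w t)"
  shows "Measurable.pred M (\<lambda>\<omega>. hit i t (\<lambda>s. w s \<omega>))"
  unfolding hit_def by measurable

text \<open>\<open>Q\<close> itself is arbitrary, but it sees only finitely many bits. The event is
  thus a finite union over the patterns of the first \<open>n + 1\<close> values, each coded by the
  set \<open>S\<close> of times where the value is true.\<close>

lemma measurable_depends_upto:
  assumes [measurable]: "\<And>t. Measurable.pred M (w t)" and Q: "depends_upto n Q"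
  shows "Measurable.pred M (\<lambda>\<omega>. Q (\<lambda>t. w t \<omega>))"
proof -
  have "Q (\<lambda>t. w t \<omega>) \<longleftrightarrow> (\<exists>S\<in>Pow {..n}. Q (\<lambda>t. t \<in> S) \<and> (\<forall>t\<in>{..n}. w t \<omega> = (t \<in> S)))" (is "_ \<longleftrightarrow> ?R") for \<omega>
  proof
    have "Q (\<lambda>t. w t \<omega>) = Q (\<lambda>t. t \<in> {t. t \<le> n \<and> w t \<omega>})"
      by (rule depends_uptoD[OF Q]) simp
    then show ?R if "Q (\<lambda>t. w t \<omega>)" using that by (intro bexI[of _ "{t. t \<le> n \<and> w t \<omega>}"]) auto
    show "Q (\<lambda>t. w t \<omega>)" if ?R
    proof -
      from that obtain S where S: "Q (\<lambda>t. t \<in> S)" "\<forall>t\<in>{..n}. w t \<omega> = (t \<in> S)" by blast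
      have "Q (\<lambda>t. w t \<omega>) = Q (\<lambda>t. t \<in> S)" using S(2) by (intro depends_uptoD[OF Q]) auto
      then show ?thesis using S(1) by simp
    qed
  qed
  note * = this
  show ?thesis unfolding * by measurable
qed

section \<open>Null recurrent renewal processes\<close>

text \<open>The renewal property is expressed without a gap distribution: given a return at
  \<open>n\<close> and any past \<open>Q\<close> up to \<open>n\<close>, the future seen from
  \<open>n\<close> is a fresh copy of the process. In \<open>null\<close> and
  \<open>recurrent\<close> the two facts about walks on infinite recurrent graphs are
  recorded.\<close>

locale renewal_process = prob_space M for M :: "'w measure" +
  fixes w :: "nat \<Rightarrow> 'w \<Rightarrow> bool"
  assumes w_meas [measurable]: "\<And>t. Measurable.pred M (w t)"
    and w_0: "AE \<omega> in M. w 0 \<omega>"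
    and renewal: "\<And>n m Q C. depends_upto n Q \<Longrightarrow> depends_upto m C \<Longrightarrow>
      \<P>(\<omega> in M. Q (\<lambda>t. w t \<omega>) \<and> w n \<omega> \<and> C (\<lambda>i. w (n + i) \<omega>)) =
      \<P>(\<omega> in M. Q (\<lambda>t. w t \<omega>) \<and> w n \<omega>) * \<P>(\<omega> in M. C (\<lambda>t. w t \<omega>))"
    and null: "(\<lambda>t. \<P>(\<omega> in M. w t \<omega>)) \<longlonglongrightarrow> 0"
    and recurrent: "AE \<omega> in M. \<exists>t>0. w t \<omega>"
begin

abbreviation u :: "nat \<Rightarrow> real" where "u t \<equiv> \<P>(\<omega> in M. w t \<omega>)"

text \<open>\<open>hit i t\<close> contains a return at \<open>t\<close> and is decided by time
  \<open>t\<close>, so it can be absorbed into the past in \<open>renewal\<close>.\<close>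

lemma renewal_hit:
  assumes B: "depends_upto t B" and C: "depends_upto m C"
  shows "\<P>(\<omega> in M. hit i t (\<lambda>t. w t \<omega>) \<and> B (\<lambda>t. w t \<omega>) \<and> C (\<lambda>i. w (t + i) \<omega>)) =
    \<P>(\<omega> in M. hit i t (\<lambda>t. w t \<omega>) \<and> B (\<lambda>t. w t \<omega>)) * \<P>(\<omega> in M. C (\<lambda>t. w t \<omega>))"
proof -
  have *: "hit i t w \<longleftrightarrow> hit i t w \<and> w t" for w by (auto simp: hit_def)
  show ?thesis
    using renewal[of t "\<lambda>w. hit i t w \<and> B w" m C] B C
    by (subst (1 2) *) (simp add: conj_ac)
qed

lemma sum_hit:
  assumes [measurable]: "Measurable.pred M R"
  shows "\<P>(\<omega> in M. i \<le> cnt T (\<lambda>t. w t \<omega>) \<and> R \<omega>) = (\<Sum>t\<le>T. \<P>(\<omega> in M. hit i t (\<lambda>t. w t \<omega>) \<and> R \<omega>))"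
proof (rule prob_sum)
  show "AE \<omega> in M. (\<forall>t\<in>{..T}. hit i t (\<lambda>t. w t \<omega>) \<and> R \<omega> \<longrightarrow> i \<le> cnt T (\<lambda>t. w t \<omega>) \<and> R \<omega>) \<and>
      (i \<le> cnt T (\<lambda>t. w t \<omega>) \<and> R \<omega> \<longrightarrow> (\<exists>!t\<in>{..T}. hit i t (\<lambda>t. w t \<omega>) \<and> R \<omega>))"
    using w_0
  proof eventually_elim
    case (elim \<omega>)
    show ?case using le_cnt_iff_hit[of "\<lambda>t. w t \<omega>" i T, OF elim] hit_unique[of i _ "\<lambda>t. w t \<omega>"] by blast
  qed
qed (auto intro: measurable_hit)

lemma sum_hit': "\<P>(\<omega> in M. i \<le> cnt T (\<lambda>t. w t \<omega>)) = (\<Sum>t\<le>T. \<P>(\<omega> in M. hit i t (\<lambda>t. w t \<omega>)))"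
  using sum_hit[of "\<lambda>_. True" i T] by simp

text \<open>Decomposition according to the first return, followed by a renewal there. Read as a
  recursion, it later recovers the first-return law from \<open>u\<close>.\<close>

lemma first_return:
  assumes "t > 0"
  shows "u t = (\<Sum>s\<le>t. \<P>(\<omega> in M. hit 1 s (\<lambda>t. w t \<omega>)) * u (t - s))"
proof -
  have "u t = \<P>(\<omega> in M. 1 \<le> cnt t (\<lambda>t. w t \<omega>) \<and> w t \<omega>)"
  proof (rule arg_cong[where f="measure M"], rule Collect_cong, rule conj_cong[OF refl])
    fix \<omega> show "w t \<omega> \<longleftrightarrow> 1 \<le> cnt t (\<lambda>t. w t \<omega>) \<and> w t \<omega>"
      using cnt_strict[of 0 t "\<lambda>t. w t \<omega>"] assms by auto
  qed
  also have "\<dots> = (\<Sum>s\<le>t. \<P>(\<omega> in M. hit 1 s (\<lambda>t. w t \<omega>) \<and> w t \<omega>))"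
    by (rule sum_hit) simp
  also have "\<dots> = (\<Sum>s\<le>t. \<P>(\<omega> in M. hit 1 s (\<lambda>t. w t \<omega>)) * u (t - s))"
  proof (rule sum.cong[OF refl])
    fix s assume "s \<in> {..t}"
    then show "\<P>(\<omega> in M. hit 1 s (\<lambda>t. w t \<omega>) \<and> w t \<omega>) = \<P>(\<omega> in M. hit 1 s (\<lambda>t. w t \<omega>)) * u (t - s)"
      using renewal_hit[of s "\<lambda>_. True" "t - s" "\<lambda>w. w (t - s)" 1] by simp
  qed
  finally show ?thesis .
qed

lemma hit_Suc:
  "\<P>(\<omega> in M. hit (Suc m) t (\<lambda>t. w t \<omega>)) =
    (\<Sum>s\<le>t. \<P>(\<omega> in M. hit m s (\<lambda>t. w t \<omega>)) * \<P>(\<omega> in M. hit 1 (t - s) (\<lambda>t. w t \<omega>)))"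
proof -
  have "\<P>(\<omega> in M. hit (Suc m) t (\<lambda>t. w t \<omega>)) =
    (\<Sum>s\<le>t. \<P>(\<omega> in M. hit m s (\<lambda>t. w t \<omega>) \<and> hit 1 (t - s) (\<lambda>i. w (s + i) \<omega>)))"
  proof (rule prob_sum)
    show "AE \<omega> in M. (\<forall>s\<in>{..t}. hit m s (\<lambda>t. w t \<omega>) \<and> hit 1 (t - s) (\<lambda>i. w (s + i) \<omega>) \<longrightarrow> hit (Suc m) t (\<lambda>t. w t \<omega>)) \<and>
      (hit (Suc m) t (\<lambda>t. w t \<omega>) \<longrightarrow> (\<exists>!s\<in>{..t}. hit m s (\<lambda>t. w t \<omega>) \<and> hit 1 (t - s) (\<lambda>i. w (s + i) \<omega>)))"
      using w_0
    proof eventually_elim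
      case (elim \<omega>)
      show ?case using hit_Suc_iff[of "\<lambda>t. w t \<omega>" m t, OF elim] hit_unique[of m _ "\<lambda>t. w t \<omega>"] by blast
    qed
  qed (auto intro!: measurable_hit)
  also have "\<dots> = (\<Sum>s\<le>t. \<P>(\<omega> in M. hit m s (\<lambda>t. w t \<omega>)) * \<P>(\<omega> in M. hit 1 (t - s) (\<lambda>t. w t \<omega>)))"
  proof (rule sum.cong[OF refl])
    fix s show "\<P>(\<omega> in M. hit m s (\<lambda>t. w t \<omega>) \<and> hit 1 (t - s) (\<lambda>i. w (s + i) \<omega>)) =
      \<P>(\<omega> in M. hit m s (\<lambda>t. w t \<omega>)) * \<P>(\<omega> in M. hit 1 (t - s) (\<lambda>t. w t \<omega>))"
      using renewal_hit[of s "\<lambda>_. True" "t - s" "hit 1 (t - s)" m] by simp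
  qed
  finally show ?thesis .
qed

lemma hit_0: "\<P>(\<omega> in M. hit 0 t (\<lambda>t. w t \<omega>)) = of_bool (t = 0)"
proof (cases "t = 0")
  case True
  have "\<P>(\<omega> in M. w 0 \<omega>) = 1" using w_0 by (subst prob_Collect_eq_1) auto
  then show ?thesis using True by (simp add: hit_def)
next
  case False
  then have "\<not> hit 0 t w" for w using cnt_strict[of 0 t w] by (auto simp: hit_def)
  then show ?thesis using False by simp
qed

text \<open>Renewal at the random time of the \<open>i\<close>-th return, obtained by summing over
  its possible values. That return happens at time \<open>i\<close> or later, so
  \<open>n \<le> i\<close> places everything \<open>B\<close> looks at in the past.\<close>

lemma hit_then:
  assumes B: "depends_upto n B" and C: "depends_upto m C" and "n \<le> i"
  shows "\<P>(\<omega> in M. (\<exists>t\<le>T. hit i t (\<lambda>t. w t \<omega>) \<and> C (\<lambda>s. w (t + s) \<omega>)) \<and> B (\<lambda>t. w t \<omega>)) =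
    \<P>(\<omega> in M. i \<le> cnt T (\<lambda>t. w t \<omega>) \<and> B (\<lambda>t. w t \<omega>)) * \<P>(\<omega> in M. C (\<lambda>t. w t \<omega>))"
proof -
  have [measurable]: "Measurable.pred M (\<lambda>\<omega>. B (\<lambda>t. w t \<omega>))"
    by (rule measurable_depends_upto[OF w_meas B])
  have [measurable]: "Measurable.pred M (\<lambda>\<omega>. C (\<lambda>s. w (t + s) \<omega>))" for t
    by (rule measurable_depends_upto[OF _ C]) simp
  have "\<P>(\<omega> in M. (\<exists>t\<le>T. hit i t (\<lambda>t. w t \<omega>) \<and> C (\<lambda>s. w (t + s) \<omega>)) \<and> B (\<lambda>t. w t \<omega>)) =
    (\<Sum>t\<le>T. \<P>(\<omega> in M. hit i t (\<lambda>t. w t \<omega>) \<and> B (\<lambda>t. w t \<omega>) \<and> C (\<lambda>s. w (t + s) \<omega>)))"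
    by (rule prob_sum) (auto intro!: AE_I2 dest: hit_unique)
  also have "\<dots> = (\<Sum>t\<le>T. \<P>(\<omega> in M. hit i t (\<lambda>t. w t \<omega>) \<and> B (\<lambda>t. w t \<omega>)) * \<P>(\<omega> in M. C (\<lambda>t. w t \<omega>)))"
  proof (rule sum.cong[OF refl])
    fix t
    show "\<P>(\<omega> in M. hit i t (\<lambda>t. w t \<omega>) \<and> B (\<lambda>t. w t \<omega>) \<and> C (\<lambda>s. w (t + s) \<omega>)) =
      \<P>(\<omega> in M. hit i t (\<lambda>t. w t \<omega>) \<and> B (\<lambda>t. w t \<omega>)) * \<P>(\<omega> in M. C (\<lambda>t. w t \<omega>))"
    proof (cases "i \<le> t")
      case True
      then show ?thesis using B C \<open>n \<le> i\<close> by (intro renewal_hit) (auto intro: depends_upto_mono)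
    next
      case False
      then have "\<not> hit i t w" for w using hit_le by blast
      then show ?thesis by simp
    qed
  qed
  also have "\<dots> = (\<Sum>t\<le>T. \<P>(\<omega> in M. hit i t (\<lambda>t. w t \<omega>) \<and> B (\<lambda>t. w t \<omega>))) * \<P>(\<omega> in M. C (\<lambda>t. w t \<omega>))"
    by (simp only: sum_distrib_right)
  finally show ?thesis by (subst sum_hit) simp_all
qed

text \<open>Induction on \<open>i\<close>: after the \<open>i\<close>-th return the process starts
  afresh, so one more return follows within a fixed time \<open>R\<close> with probability close to
  1, and \<open>hit_then\<close> multiplies the two probabilities.\<close>

lemma cnt_recurrent:
  assumes "\<epsilon> > 0"
  shows "\<exists>T0. \<forall>T\<ge>T0. \<P>(\<omega> in M. i \<le> cnt T (\<lambda>t. w t \<omega>)) > 1 - \<epsilon>"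
  using assms
proof (induction i arbitrary: \<epsilon>)
  case 0
  then show ?case using prob_space by simp
next
  case (Suc i)
  have "(\<lambda>R. \<P>(\<omega> in M. 1 \<le> cnt R (\<lambda>t. w t \<omega>))) \<longlonglongrightarrow> prob (\<Union>R. {\<omega>\<in>space M. 1 \<le> cnt R (\<lambda>t. w t \<omega>)})"
    by (rule finite_Lim_measure_incseq) (auto simp: incseq_def intro: order_trans[OF _ cnt_mono])
  also have "prob (\<Union>R. {\<omega>\<in>space M. 1 \<le> cnt R (\<lambda>t. w t \<omega>)}) = 1"
  proof -
    have "AE \<omega> in M. \<exists>R. 1 \<le> cnt R (\<lambda>t. w t \<omega>)"
      using recurrent
    proof eventually_elim
      case (elim \<omega>)
      then obtain t where "t > 0" "w t \<omega>" by blast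
      then show ?case using cnt_strict[of 0 t "\<lambda>t. w t \<omega>"] by (intro exI[of _ t]) auto
    qed
    then have "\<P>(\<omega> in M. \<exists>R. 1 \<le> cnt R (\<lambda>t. w t \<omega>)) = 1" by (subst prob_Collect_eq_1) auto
    also have "{\<omega>\<in>space M. \<exists>R. 1 \<le> cnt R (\<lambda>t. w t \<omega>)} = (\<Union>R. {\<omega>\<in>space M. 1 \<le> cnt R (\<lambda>t. w t \<omega>)})" by auto
    finally show ?thesis .
  qed
  finally have lim: "(\<lambda>R. \<P>(\<omega> in M. 1 \<le> cnt R (\<lambda>t. w t \<omega>))) \<longlonglongrightarrow> 1" .
  have "\<forall>\<^sub>F R in sequentially. 1 - \<epsilon> / 2 < \<P>(\<omega> in M. 1 \<le> cnt R (\<lambda>t. w t \<omega>))"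
    using Suc.prems by (intro order_tendstoD(1)[OF lim]) simp
  then obtain R where R: "1 - \<epsilon> / 2 < \<P>(\<omega> in M. 1 \<le> cnt R (\<lambda>t. w t \<omega>))" (is "_ < ?p")
    by (auto simp: eventually_sequentially)
  obtain T0 where T0: "\<forall>T\<ge>T0. \<P>(\<omega> in M. i \<le> cnt T (\<lambda>t. w t \<omega>)) > 1 - \<epsilon> / 2"
    using Suc.IH[of "\<epsilon> / 2"] Suc.prems by auto
  have "\<P>(\<omega> in M. Suc i \<le> cnt T (\<lambda>t. w t \<omega>)) > 1 - \<epsilon>" if T: "T \<ge> T0 + R" for T
  proof -
    have "1 - \<epsilon> < ?p * \<P>(\<omega> in M. i \<le> cnt T0 (\<lambda>t. w t \<omega>))" (is "_ < _ * ?r")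
    proof -
      \<comment> \<open>Multiplied out, this says that the product is at least
        \<open>?p + ?r - 1\<close>; each factor exceeds \<open>1 - \<epsilon> / 2\<close>.\<close>
      have "(1 - ?p) * (1 - ?r) \<ge> 0" by simp
      moreover have "?r > 1 - \<epsilon> / 2" using T0 by simp
      ultimately show ?thesis using R by (simp add: algebra_simps)
    qed
    also have "?p * ?r = \<P>(\<omega> in M. \<exists>t\<le>T0. hit i t (\<lambda>t. w t \<omega>) \<and> 1 \<le> cnt R (\<lambda>s. w (t + s) \<omega>))"
      using hit_then[of 0 "\<lambda>_. True" R "\<lambda>w. 1 \<le> cnt R w" i T0] by simp
    also have "\<dots> \<le> \<P>(\<omega> in M. Suc i \<le> cnt T (\<lambda>t. w t \<omega>))"
    proof (rule finite_measure_mono)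
      show "{\<omega>\<in>space M. \<exists>t\<le>T0. hit i t (\<lambda>t. w t \<omega>) \<and> 1 \<le> cnt R (\<lambda>s. w (t + s) \<omega>)}
        \<subseteq> {\<omega>\<in>space M. Suc i \<le> cnt T (\<lambda>t. w t \<omega>)}"
      proof safe
        fix \<omega> t assume t: "t \<le> T0" "hit i t (\<lambda>t. w t \<omega>)" "1 \<le> cnt R (\<lambda>s. w (t + s) \<omega>)"
        then have "Suc i \<le> cnt (t + R) (\<lambda>t. w t \<omega>)" by (simp add: cnt_add hit_def)
        also have "\<dots> \<le> cnt T (\<lambda>t. w t \<omega>)" using t T by (intro cnt_mono) simp
        finally show "Suc i \<le> cnt T (\<lambda>t. w t \<omega>)" .
      qed
    qed simp
    finally show ?thesis .
  qed
  then show ?case by blast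
qed

end

text \<open>The recursion \<open>first_return\<close> determines the first-return law from the
  return probabilities, \<open>hit_Suc\<close> then determines the law of every later return, and
  summing over the return time gives the counts.\<close>

lemma cnt_law_determined:
  assumes "renewal_process M w" "renewal_process M' w'"
    and u: "\<And>t. \<P>(\<omega> in M. w t \<omega>) = \<P>(\<omega> in M'. w' t \<omega>)"
  shows "\<P>(\<omega> in M. i \<le> cnt T (\<lambda>t. w t \<omega>)) = \<P>(\<omega> in M'. i \<le> cnt T (\<lambda>t. w' t \<omega>))"
proof -
  interpret A: renewal_process M w by fact
  interpret B: renewal_process M' w' by fact
  have hit1: "\<P>(\<omega> in M. hit 1 t (\<lambda>t. w t \<omega>)) = \<P>(\<omega> in M'. hit 1 t (\<lambda>t. w' t \<omega>))" for t
  proof (induction t rule: less_induct)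
    case (less t)
    show ?case
    proof (cases t)
      case 0 then show ?thesis by (simp add: hit_def)
    next
      case (Suc n)
      have w0: "A.u 0 = 1" "B.u 0 = 1" using A.w_0 B.w_0
        by (simp_all add: A.prob_Collect_eq_1 B.prob_Collect_eq_1)
      \<comment> \<open>All terms but the last agree by induction; in the last one,
        \<open>s = t\<close>, the unknown first-return probability has the coefficient
        \<open>u 0 = 1\<close>.\<close>
      have "(\<Sum>s\<le>n. \<P>(\<omega> in M. hit 1 s (\<lambda>t. w t \<omega>)) * A.u (t - s)) =
            (\<Sum>s\<le>n. \<P>(\<omega> in M'. hit 1 s (\<lambda>t. w' t \<omega>)) * B.u (t - s))"
        using less Suc by (intro sum.cong) (auto simp: u)
      then show ?thesis
        using A.first_return[of t] B.first_return[of t] u[of t] w0 Suc by simp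
    qed
  qed
  have "\<P>(\<omega> in M. hit i t (\<lambda>t. w t \<omega>)) = \<P>(\<omega> in M'. hit i t (\<lambda>t. w' t \<omega>))" for t
  proof (induction i arbitrary: t)
    case 0 then show ?case by (simp add: A.hit_0 B.hit_0)
  next
    case (Suc i) then show ?case by (simp only: A.hit_Suc B.hit_Suc hit1)
  qed
  then show ?thesis by (simp add: A.sum_hit' B.sum_hit')
qed

section \<open>Mixing of the two families of test events\<close>

context renewal_process
begin

text \<open>The count is compared with that of the sequence restarted at its \<open>n\<close>-th
  return. The restarted count is independent of \<open>B\<close> up to a small error, and since
  returns at late times are rare, the restart hardly changes whether the level \<open>m\<close> is
  reached by time \<open>T m\<close>.\<close>

lemma mixing_count:
  assumes B: "depends_upto n B" and T: "\<And>m. m \<le> T m"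
  shows "(\<lambda>m. \<P>(\<omega> in M. m \<le> cnt (T m) (\<lambda>t. w t \<omega>) \<and> B (\<lambda>t. w t \<omega>)) -
    \<P>(\<omega> in M. m \<le> cnt (T m) (\<lambda>t. w t \<omega>)) * \<P>(\<omega> in M. B (\<lambda>t. w t \<omega>))) \<longlonglongrightarrow> 0"
proof (rule LIMSEQ_I)
  fix r :: real assume r: "r > 0"
  define e where "e = r / 4"
  have e: "e > 0" using r by (simp add: e_def)
  have [measurable]: "Measurable.pred M (\<lambda>\<omega>. B (\<lambda>t. w t \<omega>))"
    by (rule measurable_depends_upto[OF w_meas B])
  obtain S where S: "\<P>(\<omega> in M. n \<le> cnt S (\<lambda>t. w t \<omega>)) > 1 - e"
    using cnt_recurrent[OF e] by blast
  \<comment> \<open>This makes a return in the \<open>S\<close> time points after \<open>T m\<close>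
    have probability at most \<open>e\<close>; \<open>T m \<ge> m \<ge> t0\<close> ensures that
    these points are late enough.\<close>
  have "\<forall>\<^sub>F t in sequentially. u t < e / real (Suc S)"
    using e by (intro order_tendstoD(2)[OF null]) simp
  then obtain t0 where t0: "\<And>t. t \<ge> t0 \<Longrightarrow> u t < e / real (Suc S)"
    by (auto simp: eventually_sequentially)
  show "\<exists>no. \<forall>m\<ge>no. norm (\<P>(\<omega> in M. m \<le> cnt (T m) (\<lambda>t. w t \<omega>) \<and> B (\<lambda>t. w t \<omega>)) -
    \<P>(\<omega> in M. m \<le> cnt (T m) (\<lambda>t. w t \<omega>)) * \<P>(\<omega> in M. B (\<lambda>t. w t \<omega>)) - 0) < r"
  proof (intro exI[of _ t0] allI impI)
    fix m assume m: "m \<ge> t0"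
    define A where "A \<omega> \<longleftrightarrow> m \<le> cnt (T m) (\<lambda>t. w t \<omega>)" for \<omega>
    \<comment> \<open>\<open>A'\<close> is \<open>A\<close> for the restarted sequence. The restart
      is at time \<open>n\<close> or later, hence after \<open>B\<close> is decided, and comes by
      time \<open>S\<close> except with probability less than \<open>e\<close>.\<close>
    define A' where "A' \<omega> \<longleftrightarrow> (\<exists>s\<le>S. hit n s (\<lambda>t. w t \<omega>) \<and> m \<le> cnt (T m) (\<lambda>i. w (s + i) \<omega>))" for \<omega>
    define D where "D \<omega> \<longleftrightarrow> B (\<lambda>t. w t \<omega>)" for \<omega>
    have [measurable]: "Measurable.pred M A" "Measurable.pred M A'" "Measurable.pred M D"
      unfolding A_def A'_def D_def by measurable
    define p where "p = \<P>(\<omega> in M. A \<omega>)"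
    have p: "0 \<le> p" "p \<le> 1" by (simp_all add: p_def)
    have ep: "e * p \<le> e" using p e by (simp add: mult_left_le)
    have A'B: "\<P>(\<omega> in M. A' \<omega> \<and> D \<omega>) = \<P>(\<omega> in M. n \<le> cnt S (\<lambda>t. w t \<omega>) \<and> D \<omega>) * p"
      unfolding A'_def D_def p_def A_def
      by (rule hit_then[OF B, where m = "T m"]) simp_all
    have A'1: "\<P>(\<omega> in M. A' \<omega>) = \<P>(\<omega> in M. n \<le> cnt S (\<lambda>t. w t \<omega>)) * p"
      using hit_then[of 0 "\<lambda>_. True" "T m" "\<lambda>w. m \<le> cnt (T m) w" n S]
      unfolding A'_def p_def A_def by simp
    \<comment> \<open>\<open>A\<close> and \<open>A'\<close> have nearly the same probability, so it suffices to bound \<open>A' - A\<close>,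
      on which a return falls in a window of fixed length after \<open>T m\<close>.\<close>
    have late: "\<P>(\<omega> in M. A' \<omega> \<and> \<not> A \<omega>) \<le> e"
    proof -
      have "\<P>(\<omega> in M. A' \<omega> \<and> \<not> A \<omega>) \<le> prob (\<Union>t\<in>{T m<..T m + S}. {\<omega>\<in>space M. w t \<omega>})"
      proof (rule finite_measure_mono)
        show "{\<omega>\<in>space M. A' \<omega> \<and> \<not> A \<omega>} \<subseteq> (\<Union>t\<in>{T m<..T m + S}. {\<omega>\<in>space M. w t \<omega>})"
        proof
          fix \<omega> assume "\<omega> \<in> {\<omega>\<in>space M. A' \<omega> \<and> \<not> A \<omega>}"
          then obtain s where \<omega>: "\<omega> \<in> space M" "s \<le> S" "hit n s (\<lambda>t. w t \<omega>)"
            "m \<le> cnt (T m) (\<lambda>i. w (s + i) \<omega>)" "\<not> m \<le> cnt (T m) (\<lambda>t. w t \<omega>)"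
            by (auto simp: A_def A'_def)
          \<comment> \<open>The returns up to time \<open>s + T m\<close> are counted in two ways,
            split at \<open>s\<close> and split at \<open>T m\<close>: the first gives at least
            \<open>n + m\<close>, and fewer than \<open>m\<close> of these occur by
            \<open>T m\<close>.\<close>
          have "0 < cnt s (\<lambda>i. w (T m + i) \<omega>)"
            using \<omega> cnt_add[of s "T m" "\<lambda>t. w t \<omega>"] cnt_add[of "T m" s "\<lambda>t. w t \<omega>"]
            by (simp add: add.commute)
          then obtain i where "i \<in> {0<..s}" "w (T m + i) \<omega>"
            unfolding cnt_def by (metis (no_types, lifting) card_gt_0_iff ex_in_conv mem_Collect_eq)
          then show "\<omega> \<in> (\<Union>t\<in>{T m<..T m + S}. {\<omega>\<in>space M. w t \<omega>})"
            using \<omega> by (intro UN_I[of "T m + i"]) auto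
        qed
      qed auto
      also have "\<dots> \<le> (\<Sum>t\<in>{T m<..T m + S}. u t)"
        by (rule finite_measure_subadditive_finite) auto
      also have "\<dots> \<le> (\<Sum>t\<in>{T m<..T m + S}. e / real (Suc S))"
        using T[of m] m by (intro sum_mono less_imp_le t0) auto
      also have "\<dots> \<le> e" using e by (simp add: field_simps)
      finally show ?thesis .
    qed
    have split: "\<P>(\<omega> in M. P \<omega>) = \<P>(\<omega> in M. P \<omega> \<and> Q \<omega>) + \<P>(\<omega> in M. P \<omega> \<and> \<not> Q \<omega>)"
      if [measurable]: "Measurable.pred M P" "Measurable.pred M Q" for P Q
    proof -
      have "\<P>(\<omega> in M. P \<omega>) = prob ({\<omega>\<in>space M. P \<omega> \<and> Q \<omega>} \<union> {\<omega>\<in>space M. P \<omega> \<and> \<not> Q \<omega>})"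
        by (intro arg_cong[where f="measure M"]) auto
      also have "\<dots> = \<P>(\<omega> in M. P \<omega> \<and> Q \<omega>) + \<P>(\<omega> in M. P \<omega> \<and> \<not> Q \<omega>)"
        by (rule finite_measure_Union) auto
      finally show ?thesis .
    qed
    have mono: "\<P>(\<omega> in M. P \<omega>) \<le> \<P>(\<omega> in M. Q \<omega>)"
      if "\<And>\<omega>. P \<omega> \<Longrightarrow> Q \<omega>" and [measurable]: "Measurable.pred M Q" for P Q
      by (rule finite_measure_mono) (auto simp: that(1))
    have "\<P>(\<omega> in M. A' \<omega>) = \<P>(\<omega> in M. A' \<omega> \<and> A \<omega>) + \<P>(\<omega> in M. A' \<omega> \<and> \<not> A \<omega>)"
      by (rule split) simp_all
    moreover have "p = \<P>(\<omega> in M. A \<omega> \<and> A' \<omega>) + \<P>(\<omega> in M. A \<omega> \<and> \<not> A' \<omega>)"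
      unfolding p_def by (rule split) simp_all
    moreover have "\<P>(\<omega> in M. A \<omega> \<and> A' \<omega>) = \<P>(\<omega> in M. A' \<omega> \<and> A \<omega>)"
      by (simp only: conj_commute)
    moreover have "\<P>(\<omega> in M. n \<le> cnt S (\<lambda>t. w t \<omega>)) * p \<ge> p - e"
      using mult_right_mono[OF less_imp_le[OF S] p(1)] ep
      by (simp add: algebra_simps)
    ultimately have out: "\<P>(\<omega> in M. A \<omega> \<and> \<not> A' \<omega>) \<le> 2 * e"
      using late A'1 by linarith
    have 1: "\<P>(\<omega> in M. A \<omega> \<and> D \<omega>) \<le> \<P>(\<omega> in M. A' \<omega> \<and> D \<omega>) + 2 * e"
    proof -
      have "\<P>(\<omega> in M. A \<omega> \<and> D \<omega>) = \<P>(\<omega> in M. (A \<omega> \<and> D \<omega>) \<and> A' \<omega>) + \<P>(\<omega> in M. (A \<omega> \<and> D \<omega>) \<and> \<not> A' \<omega>)"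
        by (rule split) simp_all
      also have "\<dots> \<le> \<P>(\<omega> in M. A' \<omega> \<and> D \<omega>) + \<P>(\<omega> in M. A \<omega> \<and> \<not> A' \<omega>)"
        by (intro add_mono mono) auto
      finally show ?thesis using out by simp
    qed
    have 2: "\<P>(\<omega> in M. A' \<omega> \<and> D \<omega>) \<le> \<P>(\<omega> in M. A \<omega> \<and> D \<omega>) + e"
    proof -
      have "\<P>(\<omega> in M. A' \<omega> \<and> D \<omega>) = \<P>(\<omega> in M. (A' \<omega> \<and> D \<omega>) \<and> A \<omega>) + \<P>(\<omega> in M. (A' \<omega> \<and> D \<omega>) \<and> \<not> A \<omega>)"
        by (rule split) simp_all
      also have "\<dots> \<le> \<P>(\<omega> in M. A \<omega> \<and> D \<omega>) + \<P>(\<omega> in M. A' \<omega> \<and> \<not> A \<omega>)"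
        by (intro add_mono mono) auto
      finally show ?thesis using late by simp
    qed
    have 3: "\<P>(\<omega> in M. n \<le> cnt S (\<lambda>t. w t \<omega>) \<and> D \<omega>) \<le> \<P>(\<omega> in M. D \<omega>)"
      by (intro mono) auto
    have 4: "\<P>(\<omega> in M. D \<omega>) - e \<le> \<P>(\<omega> in M. n \<le> cnt S (\<lambda>t. w t \<omega>) \<and> D \<omega>)"
    proof -
      have "\<P>(\<omega> in M. D \<omega>) = \<P>(\<omega> in M. D \<omega> \<and> n \<le> cnt S (\<lambda>t. w t \<omega>)) + \<P>(\<omega> in M. D \<omega> \<and> \<not> n \<le> cnt S (\<lambda>t. w t \<omega>))"
        by (rule split) simp_all
      also have "\<dots> \<le> \<P>(\<omega> in M. n \<le> cnt S (\<lambda>t. w t \<omega>) \<and> D \<omega>) + \<P>(\<omega> in M. True \<and> \<not> n \<le> cnt S (\<lambda>t. w t \<omega>))"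
        by (intro add_mono mono) auto
      also have "\<P>(\<omega> in M. True \<and> \<not> n \<le> cnt S (\<lambda>t. w t \<omega>)) = 1 - \<P>(\<omega> in M. n \<le> cnt S (\<lambda>t. w t \<omega>))"
        using split[of "\<lambda>_. True" "\<lambda>\<omega>. n \<le> cnt S (\<lambda>t. w t \<omega>)"] prob_space by simp
      finally show ?thesis using S by simp
    qed
    have "\<P>(\<omega> in M. A' \<omega> \<and> D \<omega>) \<le> \<P>(\<omega> in M. D \<omega>) * p"
      unfolding A'B using 3 p by (intro mult_right_mono)
    moreover have "\<P>(\<omega> in M. D \<omega>) * p - e \<le> \<P>(\<omega> in M. A' \<omega> \<and> D \<omega>)"
      unfolding A'B using mult_right_mono[OF 4 p(1)] ep
      by (simp add: algebra_simps)
    ultimately have "\<bar>\<P>(\<omega> in M. A \<omega> \<and> D \<omega>) - p * \<P>(\<omega> in M. D \<omega>)\<bar> \<le> 3 * e"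
      using 1 2 e by (simp add: mult.commute abs_le_iff)
    also have "3 * e < r" using r by (simp add: e_def)
    finally show "norm (\<P>(\<omega> in M. m \<le> cnt (T m) (\<lambda>t. w t \<omega>) \<and> B (\<lambda>t. w t \<omega>)) -
      \<P>(\<omega> in M. m \<le> cnt (T m) (\<lambda>t. w t \<omega>)) * \<P>(\<omega> in M. B (\<lambda>t. w t \<omega>)) - 0) < r"
      by (simp add: A_def D_def p_def)
  qed
qed

text \<open>For \<open>i \<ge> n\<close>, \<open>hit_then\<close> gives an exact product with the
  factor \<open>u k\<close>. The other factor tends to the probability of \<open>B\<close>, because
  the \<open>i\<close>-th return occurs by \<open>T i\<close> with probability tending to 1.\<close>

lemma mixing_revisit:
  assumes B: "depends_upto n B"
    and T: "(\<lambda>i. \<P>(\<omega> in M. i \<le> cnt (T i) (\<lambda>t. w t \<omega>))) \<longlonglongrightarrow> 1"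
  shows "(\<lambda>i. \<P>(\<omega> in M. (\<exists>t\<le>T i. hit i t (\<lambda>t. w t \<omega>) \<and> w (t + k) \<omega>) \<and> B (\<lambda>t. w t \<omega>)))
    \<longlonglongrightarrow> u k * \<P>(\<omega> in M. B (\<lambda>t. w t \<omega>))"
proof -
  have [measurable]: "Measurable.pred M (\<lambda>\<omega>. B (\<lambda>t. w t \<omega>))"
    by (rule measurable_depends_upto[OF w_meas B])
  have "(\<lambda>i. \<P>(\<omega> in M. i \<le> cnt (T i) (\<lambda>t. w t \<omega>) \<and> B (\<lambda>t. w t \<omega>))) \<longlonglongrightarrow> \<P>(\<omega> in M. B (\<lambda>t. w t \<omega>))"
  proof (rule tendsto_sandwich)
    show "\<forall>\<^sub>F i in sequentially. \<P>(\<omega> in M. i \<le> cnt (T i) (\<lambda>t. w t \<omega>)) + \<P>(\<omega> in M. B (\<lambda>t. w t \<omega>)) - 1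
        \<le> \<P>(\<omega> in M. i \<le> cnt (T i) (\<lambda>t. w t \<omega>) \<and> B (\<lambda>t. w t \<omega>))"
    proof (rule always_eventually, rule allI)
      fix i
      let ?F = "{\<omega>\<in>space M. i \<le> cnt (T i) (\<lambda>t. w t \<omega>)}" and ?B = "{\<omega>\<in>space M. B (\<lambda>t. w t \<omega>)}"
      have "prob (?F \<union> ?B) = prob ?F + prob (?B - ?F)" by (rule finite_measure_Union') auto
      also have "prob (?B - ?F) = prob ?B - prob (?F \<inter> ?B)"
        by (subst finite_measure_Diff') (auto simp: Int_commute)
      also have "?F \<inter> ?B = {\<omega>\<in>space M. i \<le> cnt (T i) (\<lambda>t. w t \<omega>) \<and> B (\<lambda>t. w t \<omega>)}" by auto
      finally show "prob ?F + prob ?B - 1 \<le> \<P>(\<omega> in M. i \<le> cnt (T i) (\<lambda>t. w t \<omega>) \<and> B (\<lambda>t. w t \<omega>))"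
        using prob_le_1[of "?F \<union> ?B"] by linarith
    qed
    show "\<forall>\<^sub>F i in sequentially. \<P>(\<omega> in M. i \<le> cnt (T i) (\<lambda>t. w t \<omega>) \<and> B (\<lambda>t. w t \<omega>)) \<le> \<P>(\<omega> in M. B (\<lambda>t. w t \<omega>))"
      by (intro always_eventually allI finite_measure_mono) auto
    show "(\<lambda>i. \<P>(\<omega> in M. i \<le> cnt (T i) (\<lambda>t. w t \<omega>)) + \<P>(\<omega> in M. B (\<lambda>t. w t \<omega>)) - 1) \<longlonglongrightarrow> \<P>(\<omega> in M. B (\<lambda>t. w t \<omega>))"
      using tendsto_diff[OF tendsto_add[OF T tendsto_const] tendsto_const, of "\<P>(\<omega> in M. B (\<lambda>t. w t \<omega>))" 1] by simp
  qed simp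
  from tendsto_mult_right[OF this, of "u k"]
  have lim: "(\<lambda>i. \<P>(\<omega> in M. i \<le> cnt (T i) (\<lambda>t. w t \<omega>) \<and> B (\<lambda>t. w t \<omega>)) * u k) \<longlonglongrightarrow> u k * \<P>(\<omega> in M. B (\<lambda>t. w t \<omega>))"
    by (simp add: mult.commute)
  show ?thesis
  proof (rule Lim_transform_eventually[OF lim])
    show "\<forall>\<^sub>F i in sequentially. \<P>(\<omega> in M. i \<le> cnt (T i) (\<lambda>t. w t \<omega>) \<and> B (\<lambda>t. w t \<omega>)) * u k =
      \<P>(\<omega> in M. (\<exists>t\<le>T i. hit i t (\<lambda>t. w t \<omega>) \<and> w (t + k) \<omega>) \<and> B (\<lambda>t. w t \<omega>))"
      using eventually_ge_at_top[of n]
    proof eventually_elim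
      case (elim i)
      then show ?case using hit_then[OF B, of k "\<lambda>w. w k" i "T i"] by simp
    qed
  qed
qed

end

section \<open>Transfer of mixing events under absolute continuity, and the counting level to be
  tested\<close>

text \<open>Mixing says that the centred indicators \<open>g i\<close> integrate to 0 in the limit
  against indicators of sets in \<open>G\<close>. This extends to all measurable sets and then to
  all integrable functions. Against the density of \<open>K\<close>, whose integral is 1, the
  integral of \<open>g i\<close> is exactly the difference in question.\<close>

lemma mixing_absolutely_continuous:
  fixes A :: "nat \<Rightarrow> 'a set"
  assumes N: "prob_space N" and K: "prob_space K" and ac: "absolutely_continuous N K" and KN: "sets K = sets N"
    and G: "Int_stable G" "G \<subseteq> Pow (space N)" "sets N = sigma_sets (space N) G"
    and A: "\<And>i. A i \<in> sets N"
    and mix: "\<And>B. B \<in> G \<Longrightarrow> (\<lambda>i. measure N (A i \<inter> B) - measure N (A i) * measure N B) \<longlonglongrightarrow> 0"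
  shows "(\<lambda>i. measure K (A i) - measure N (A i)) \<longlonglongrightarrow> 0"
proof -
  interpret N: prob_space N by fact
  interpret K: prob_space K by fact
  define g where "g i x = indicator (A i) x - measure N (A i)" for i x
  have [measurable]: "A i \<in> sets N" for i by (rule A)
  have g1: "\<bar>g i x\<bar> \<le> 1" for i x
    using N.prob_le_1[of "A i"] measure_nonneg[of N "A i"] unfolding g_def indicator_def by auto
  have [measurable]: "g i \<in> borel_measurable N" for i unfolding g_def by measurable
  have int: "integrable N (\<lambda>x. f x * g i x)" if "integrable N f" for f i
  proof (rule Bochner_Integration.integrable_bound)
    show "integrable N f" by fact
    show "AE x in N. norm (f x * g i x) \<le> norm (f x)"
      using g1 by (auto simp: abs_mult intro!: AE_I2 mult_left_le)
  qed (use that in simp)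
  \<comment> \<open>First extension: the sets with this limit are closed under complements and
    countable disjoint unions, so an intersection-stable generator suffices.\<close>
  have sets: "(\<lambda>i. measure N (A i \<inter> B) - measure N (A i) * measure N B) \<longlonglongrightarrow> 0" if "B \<in> sets N" for B
    using G(1,2) that[unfolded G(3)]
  proof (induction rule: sigma_sets_induct_disjoint)
    case (basic B)
    then show ?case by (rule mix)
  next
    case empty
    then show ?case by simp
  next
    case (compl B)
    then have B [measurable]: "B \<in> sets N" by (simp add: G(3))
    have "measure N (A i \<inter> (space N - B)) = measure N (A i) - measure N (A i \<inter> B)" for i
    proof -
      have "A i \<inter> (space N - B) = A i - A i \<inter> B" using sets.sets_into_space[OF A] by auto
      then show ?thesis by (simp add: N.finite_measure_Diff)
    qed
    then have "measure N (A i \<inter> (space N - B)) - measure N (A i) * measure N (space N - B) =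
        - (measure N (A i \<inter> B) - measure N (A i) * measure N B)" for i
      by (simp add: N.prob_compl algebra_simps)
    then show ?case using tendsto_minus[OF compl(2)] by simp
  next
    case (union B)
    then have B [measurable]: "B j \<in> sets N" for j by (auto simp: G(3))
    have sB: "(\<lambda>j. measure N (B j)) sums measure N (\<Union>j. B j)"
      by (rule N.finite_measure_UNION) (use union B in auto)
    have sAB: "(\<lambda>j. measure N (A i \<inter> B j)) sums measure N (A i \<inter> (\<Union>j. B j))" for i
    proof -
      have "(\<lambda>j. measure N (A i \<inter> B j)) sums measure N (\<Union>j. A i \<inter> B j)"
        by (rule N.finite_measure_UNION) (use union B in \<open>auto simp: disjoint_family_on_def\<close>)
      then show ?thesis by simp
    qed
    define a where "a j i = measure N (A i \<inter> B j) - measure N (A i) * measure N (B j)" for j i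
    have a_sums: "(\<lambda>j. a j i) sums (measure N (A i \<inter> (\<Union>j. B j)) - measure N (A i) * measure N (\<Union>j. B j))" for i
      unfolding a_def by (intro sums_diff sAB sums_mult sB)
    have bound: "norm (a j i) \<le> measure N (B j)" for i j
    proof -
      have "measure N (A i \<inter> B j) \<le> measure N (B j)" by (intro N.finite_measure_mono) auto
      moreover have "measure N (A i) * measure N (B j) \<le> measure N (B j)"
        by (intro mult_left_le_one_le) auto
      ultimately show ?thesis unfolding a_def
        by (smt (verit) measure_nonneg mult_nonneg_nonneg real_norm_def)
    qed
    \<comment> \<open>The bound \<open>measure N (B j)\<close> is summable in \<open>j\<close> and
      uniform in \<open>i\<close>, so the limit in \<open>i\<close> may be taken term by
      term.\<close>
    have "\<forall>\<^sub>F (j, i) in sequentially \<times>\<^sub>F sequentially. norm (a j i) \<le> measure N (B j)"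
      by (rule always_eventually) (use bound in auto)
    moreover have "summable (\<lambda>j. measure N (B j))" using sB by (rule sums_summable)
    moreover have "(\<lambda>i. a j i) \<longlonglongrightarrow> 0" for j unfolding a_def by (rule union(3))
    ultimately have "((\<lambda>i. suminf (\<lambda>j. a j i)) \<longlongrightarrow> suminf (\<lambda>j. 0 :: real)) sequentially"
      using tannerys_theorem[of a "\<lambda>_. 0" sequentially "\<lambda>j. measure N (B j)"] by simp
    then show ?case using a_sums by (simp add: sums_iff)
  qed
  \<comment> \<open>Second extension, to integrable functions: \<open>g i\<close> is bounded by 1
    uniformly in \<open>i\<close>, so the property survives approximation in mean.\<close>
  have "(\<lambda>i. \<integral>x. f x * g i x \<partial>N) \<longlonglongrightarrow> 0" if "integrable N f" for f :: "'a \<Rightarrow> real"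
    using that
  proof (induction rule: integrable_induct)
    case (base B c)
    have "(\<integral>x. (indicator B x *\<^sub>R c) * g i x \<partial>N) = c * (measure N (A i \<inter> B) - measure N (A i) * measure N B)" for i
    proof -
      have "(\<integral>x. (indicator B x *\<^sub>R c) * g i x \<partial>N) =
        (\<integral>x. c * (indicator (A i \<inter> B) x - measure N (A i) * indicator B x) \<partial>N)"
        by (intro Bochner_Integration.integral_cong) (auto simp: g_def indicator_def)
      also have "\<dots> = c * (measure N (A i \<inter> B) - measure N (A i) * measure N B)"
        using base(1) by (simp add: N.emeasure_eq_measure)
      finally show ?thesis .
    qed
    then show ?case using tendsto_mult_right_zero[OF sets[OF base(1)], of c] by simp
  next
    case (add f h)
    then show ?case
      using tendsto_add[OF add(3,4)] by (simp add: distrib_right int)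
  next
    case (lim f s)
    have [measurable]: "f \<in> borel_measurable N" "\<And>k. s k \<in> borel_measurable N"
      using lim by auto
    have "(\<lambda>k. \<integral>x. \<bar>f x - s k x\<bar> \<partial>N) \<longlonglongrightarrow> (\<integral>x. 0 \<partial>N)"
    proof (rule integral_dominated_convergence)
      \<comment> \<open>The induction rule supplies approximations bounded by twice \<open>f\<close>
        in absolute value, whence the factor 3 for the difference.\<close>
      show "integrable N (\<lambda>x. 3 * \<bar>f x\<bar>)" using lim(4) by simp
      show "AE x in N. (\<lambda>k. \<bar>f x - s k x\<bar>) \<longlonglongrightarrow> 0"
      proof (rule AE_I2)
        fix x assume "x \<in> space N"
        from tendsto_rabs[OF tendsto_diff[OF tendsto_const[of "f x"] lim(2)[OF this]]]
        show "(\<lambda>k. \<bar>f x - s k x\<bar>) \<longlonglongrightarrow> 0" by simp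
      qed
      show "AE x in N. norm \<bar>f x - s k x\<bar> \<le> 3 * \<bar>f x\<bar>" for k
      proof (rule AE_I2)
        fix x assume "x \<in> space N"
        from lim(3)[OF this, of k] show "norm \<bar>f x - s k x\<bar> \<le> 3 * \<bar>f x\<bar>" by simp
      qed
    qed auto
    then have approx: "(\<lambda>k. \<integral>x. \<bar>f x - s k x\<bar> \<partial>N) \<longlonglongrightarrow> 0" by simp
    show ?case
    proof (rule LIMSEQ_I)
      fix r :: real assume r: "r > 0"
      have "\<forall>\<^sub>F k in sequentially. (\<integral>x. \<bar>f x - s k x\<bar> \<partial>N) < r / 2"
        using r by (intro order_tendstoD(2)[OF approx]) simp
      then obtain k where k: "(\<integral>x. \<bar>f x - s k x\<bar> \<partial>N) < r / 2" by (auto simp: eventually_sequentially)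
      obtain i0 where i0: "\<And>i. i \<ge> i0 \<Longrightarrow> \<bar>\<integral>x. s k x * g i x \<partial>N\<bar> < r / 2"
        using LIMSEQ_D[OF lim(5)[of k], of "r / 2"] r by auto
      have "\<bar>\<integral>x. f x * g i x \<partial>N\<bar> < r" if "i \<ge> i0" for i
      proof -
        have "(\<integral>x. f x * g i x \<partial>N) = (\<integral>x. s k x * g i x \<partial>N) + (\<integral>x. (f x - s k x) * g i x \<partial>N)"
          using int[OF lim(1)[of k], of i] int[OF lim(4), of i] by (simp add: left_diff_distrib)
        moreover have "\<bar>\<integral>x. (f x - s k x) * g i x \<partial>N\<bar> \<le> (\<integral>x. \<bar>f x - s k x\<bar> \<partial>N)"
        proof -
          have "\<bar>\<integral>x. (f x - s k x) * g i x \<partial>N\<bar> \<le> (\<integral>x. \<bar>(f x - s k x) * g i x\<bar> \<partial>N)"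
            by (rule integral_abs_bound)
          also have "\<dots> \<le> (\<integral>x. \<bar>f x - s k x\<bar> \<partial>N)"
            using lim(1)[of k] lim(4) g1
            by (intro integral_mono int integrable_abs Bochner_Integration.integrable_diff) (auto simp: abs_mult intro!: mult_left_le)
          finally show ?thesis .
        qed
        ultimately show ?thesis using i0[OF that] k by linarith
      qed
      then show "\<exists>no. \<forall>i\<ge>no. norm ((\<integral>x. f x * g i x \<partial>N) - 0) < r" by auto
    qed
  qed
  note conv = this
  obtain D where D: "D \<in> borel_measurable N" "AE x in N. RN_deriv N K x = ennreal (D x)" "\<And>x. 0 \<le> D x"
    using N.real_RN_deriv[OF K.finite_measure_axioms ac KN] by metis
  note [measurable] = D(1)
  have KD: "K = density N D"
    using N.density_RN_deriv[OF ac KN] density_cong[OF borel_measurable_RN_deriv _ D(2)] by simp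
  have D_int: "integrable N D"
  proof -
    have "integrable K (\<lambda>_. 1 :: real)" by simp
    then show ?thesis using D(3) unfolding KD by (subst (asm) integrable_density) auto
  qed
  have D1: "(\<integral>x. D x \<partial>N) = 1"
  proof -
    have "(\<integral>x. 1 \<partial>K) = (1 :: real)" using K.prob_space by simp
    then show ?thesis using D(3) unfolding KD by (subst (asm) integral_density) auto
  qed
  have "measure K (A i) - measure N (A i) = (\<integral>x. D x * g i x \<partial>N)" for i
  proof -
    have "measure K (A i) = (\<integral>x. indicator (A i) x \<partial>K)" using A KN by simp
    also have "\<dots> = (\<integral>x. D x * indicator (A i) x \<partial>N)"
      using D(3) unfolding KD by (subst integral_density) auto
    also have "\<dots> - measure N (A i) * (\<integral>x. D x \<partial>N) = (\<integral>x. D x * g i x \<partial>N)"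
    proof -
      have "integrable N (\<lambda>x. D x * indicator (A i) x)"
        using D_int by (intro integrable_real_mult_indicator) auto
      then show ?thesis using D_int
        by (simp add: g_def right_diff_distrib mult.commute)
    qed
    finally show ?thesis using D1 by simp
  qed
  then show ?thesis using conv[OF D_int] by simp
qed

text \<open>\<open>T m\<close> is the first time at which the probability reaches 1/4. One step
  earlier it is below 1/4, and a single step adds at most \<open>u (T m)\<close>, which is
  eventually below 1/4 since \<open>T m \<ge> m\<close>. Nullity thus prevents a jump past
  1/2.\<close>

lemma (in renewal_process) intermediate_count:
  "\<exists>T. (\<forall>m. m \<le> T m) \<and> (\<forall>\<^sub>F m in sequentially.
    \<P>(\<omega> in M. m \<le> cnt (T m) (\<lambda>t. w t \<omega>)) \<in> {1 / 4..1 / 2})"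
proof -
  define T where "T m = (LEAST T. \<P>(\<omega> in M. m \<le> cnt T (\<lambda>t. w t \<omega>)) \<ge> 1 / 4)" for m
  have T: "\<P>(\<omega> in M. m \<le> cnt (T m) (\<lambda>t. w t \<omega>)) \<ge> 1 / 4" for m
  proof -
    obtain T0 where "\<P>(\<omega> in M. m \<le> cnt T0 (\<lambda>t. w t \<omega>)) > 1 - 3 / 4"
      using cnt_recurrent[of "3 / 4" m] by auto
    then have "\<P>(\<omega> in M. m \<le> cnt T0 (\<lambda>t. w t \<omega>)) \<ge> 1 / 4" by simp
    then show ?thesis unfolding T_def by (rule LeastI)
  qed
  have T_ge: "m \<le> T m" for m
  proof (rule ccontr)
    assume "\<not> m \<le> T m"
    then have "\<not> m \<le> cnt (T m) w" for w using cnt_le[of "T m" w] by linarith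
    then show False using T[of m] by simp
  qed
  have up: "\<P>(\<omega> in M. m \<le> cnt (T m) (\<lambda>t. w t \<omega>)) \<le> 1 / 4 + u (T m)" if m: "m > 0" for m
  proof -
    obtain n where n: "T m = Suc n" using T_ge[of m] m by (cases "T m") auto
    have "\<P>(\<omega> in M. m \<le> cnt (T m) (\<lambda>t. w t \<omega>)) \<le>
        prob ({\<omega>\<in>space M. m \<le> cnt n (\<lambda>t. w t \<omega>)} \<union> {\<omega>\<in>space M. w (T m) \<omega>})"
      by (rule finite_measure_mono) (auto simp: n cnt_Suc of_bool_def split: if_splits)
    also have "\<dots> \<le> \<P>(\<omega> in M. m \<le> cnt n (\<lambda>t. w t \<omega>)) + u (T m)"
      by (rule measure_Un_le) auto
    finally have "\<P>(\<omega> in M. m \<le> cnt (T m) (\<lambda>t. w t \<omega>)) \<le> \<P>(\<omega> in M. m \<le> cnt n (\<lambda>t. w t \<omega>)) + u (T m)" .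
    moreover have "\<not> \<P>(\<omega> in M. m \<le> cnt n (\<lambda>t. w t \<omega>)) \<ge> 1 / 4"
      using not_less_Least[of n "\<lambda>T. \<P>(\<omega> in M. m \<le> cnt T (\<lambda>t. w t \<omega>)) \<ge> 1 / 4"] n by (simp add: T_def)
    ultimately show ?thesis by simp
  qed
  have "\<forall>\<^sub>F t in sequentially. u t < 1 / 4" by (intro order_tendstoD(2)[OF null]) simp
  then obtain t0 where t0: "\<And>t. t \<ge> t0 \<Longrightarrow> u t < 1 / 4" by (auto simp: eventually_sequentially)
  have "\<forall>\<^sub>F m in sequentially. \<P>(\<omega> in M. m \<le> cnt (T m) (\<lambda>t. w t \<omega>)) \<in> {1 / 4..1 / 2}"
    using eventually_ge_at_top[of "Suc t0"]
  proof eventually_elim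
    case (elim m)
    then have "u (T m) < 1 / 4" using t0 T_ge[of m] by simp
    then show ?case using up[of m] T[of m] elim by simp
  qed
  then show ?thesis using T_ge by blast
qed

section \<open>The union of two independent renewal processes\<close>

definition indep_processes :: "'w measure \<Rightarrow> (nat \<Rightarrow> 'w \<Rightarrow> bool) \<Rightarrow> (nat \<Rightarrow> 'w \<Rightarrow> bool) \<Rightarrow> bool" where
  "indep_processes M x y \<longleftrightarrow> (\<forall>n Q R. depends_upto n Q \<longrightarrow> depends_upto n R \<longrightarrow>
    \<P>(\<omega> in M. Q (\<lambda>t. x t \<omega>) \<and> R (\<lambda>t. y t \<omega>)) = \<P>(\<omega> in M. Q (\<lambda>t. x t \<omega>)) * \<P>(\<omega> in M. R (\<lambda>t. y t \<omega>)))"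

lemma indep_processesD:
  assumes "indep_processes M x y" "depends_upto n Q" "depends_upto m R"
  shows "\<P>(\<omega> in M. Q (\<lambda>t. x t \<omega>) \<and> R (\<lambda>t. y t \<omega>)) = \<P>(\<omega> in M. Q (\<lambda>t. x t \<omega>)) * \<P>(\<omega> in M. R (\<lambda>t. y t \<omega>))"
  using assms depends_upto_mono[of n Q "max n m"] depends_upto_mono[of m R "max n m"]
  unfolding indep_processes_def by simp

lemma indep_processes_commute:
  assumes "indep_processes M x y" shows "indep_processes M y x"
  unfolding indep_processes_def
proof (intro allI impI)
  fix n Q R assume "depends_upto n Q" "depends_upto n R"
  from indep_processesD[OF assms this(2,1)]
  show "\<P>(\<omega> in M. Q (\<lambda>t. y t \<omega>) \<and> R (\<lambda>t. x t \<omega>)) = \<P>(\<omega> in M. Q (\<lambda>t. y t \<omega>)) * \<P>(\<omega> in M. R (\<lambda>t. x t \<omega>))"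
    by (subst conj_commute, subst mult.commute)
qed

text \<open>The past may now involve \<open>y\<close> as well. Splitting over the finitely many
  patterns \<open>S\<close> of \<open>y\<close> up to time \<open>n\<close> turns \<open>R\<close>
  into a predicate of \<open>x\<close> alone; independence factors out the pattern, and then
  \<open>x\<close> renews.\<close>

lemma joint_renewal:
  assumes "renewal_process M x" "renewal_process M y" and ind: "indep_processes M x y"
    and R: "\<And>b. depends_upto n (\<lambda>a. R a b)" "\<And>a. depends_upto n (R a)" and C: "depends_upto m C"
  shows "\<P>(\<omega> in M. R (\<lambda>t. x t \<omega>) (\<lambda>t. y t \<omega>) \<and> x n \<omega> \<and> C (\<lambda>i. x (n + i) \<omega>)) =
    \<P>(\<omega> in M. R (\<lambda>t. x t \<omega>) (\<lambda>t. y t \<omega>) \<and> x n \<omega>) * \<P>(\<omega> in M. C (\<lambda>t. x t \<omega>))"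
proof -
  interpret X: renewal_process M x by fact
  interpret Y: renewal_process M y by fact
  define F where "F S w \<longleftrightarrow> (\<forall>t\<le>n. w t = (t \<in> S))" for S and w :: "nat \<Rightarrow> bool"
  have F: "depends_upto n (F S)" for S
    unfolding F_def by (rule depends_uptoI) simp
  have RS: "R a b \<longleftrightarrow> R a (\<lambda>t. t \<in> S)" if "F S b" for a b S
    using that by (intro depends_uptoD[OF R(2)]) (simp add: F_def)
  have decomp: "\<P>(\<omega> in M. R (\<lambda>t. x t \<omega>) (\<lambda>t. y t \<omega>) \<and> D (\<lambda>t. x t \<omega>)) =
    (\<Sum>S\<in>Pow {..n}. \<P>(\<omega> in M. R (\<lambda>t. x t \<omega>) (\<lambda>t. t \<in> S) \<and> D (\<lambda>t. x t \<omega>)) * \<P>(\<omega> in M. F S (\<lambda>t. y t \<omega>)))"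
    if D: "depends_upto k D" for k D
  proof -
    have [measurable]: "Measurable.pred M (\<lambda>\<omega>. D (\<lambda>t. x t \<omega>))" by (rule measurable_depends_upto[OF X.w_meas D])
    have [measurable]: "Measurable.pred M (\<lambda>\<omega>. F S (\<lambda>t. y t \<omega>))" for S by (rule measurable_depends_upto[OF Y.w_meas F])
    have [measurable]: "Measurable.pred M (\<lambda>\<omega>. R (\<lambda>t. x t \<omega>) b)" for b by (rule measurable_depends_upto[OF X.w_meas R(1)])
    have ex: "R a b \<longleftrightarrow> (\<exists>S\<in>Pow {..n}. R a (\<lambda>t. t \<in> S) \<and> F S b)" for a b
    proof
      assume "R a b"
      moreover have "F {t. t \<le> n \<and> b t} b" by (simp add: F_def)
      ultimately show "\<exists>S\<in>Pow {..n}. R a (\<lambda>t. t \<in> S) \<and> F S b"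
        using RS by (intro bexI[of _ "{t. t \<le> n \<and> b t}"]) auto
    qed (use RS in blast)
    have uniq: "S = S'" if "F S b" "F S' b" "S \<in> Pow {..n}" "S' \<in> Pow {..n}" for S S' b
      using that by (auto simp: F_def)
    have "\<P>(\<omega> in M. R (\<lambda>t. x t \<omega>) (\<lambda>t. y t \<omega>) \<and> D (\<lambda>t. x t \<omega>)) =
      (\<Sum>S\<in>Pow {..n}. \<P>(\<omega> in M. (R (\<lambda>t. x t \<omega>) (\<lambda>t. t \<in> S) \<and> D (\<lambda>t. x t \<omega>)) \<and> F S (\<lambda>t. y t \<omega>)))"
    proof (rule X.prob_sum)
      show "{\<omega>\<in>space M. R (\<lambda>t. x t \<omega>) (\<lambda>t. y t \<omega>) \<and> D (\<lambda>t. x t \<omega>)} \<in> sets M"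
        unfolding ex[of "\<lambda>t. x t _" "\<lambda>t. y t _"] by measurable
      show "AE \<omega> in M. (\<forall>S\<in>Pow {..n}. (R (\<lambda>t. x t \<omega>) (\<lambda>t. t \<in> S) \<and> D (\<lambda>t. x t \<omega>)) \<and> F S (\<lambda>t. y t \<omega>)
          \<longrightarrow> R (\<lambda>t. x t \<omega>) (\<lambda>t. y t \<omega>) \<and> D (\<lambda>t. x t \<omega>)) \<and>
        (R (\<lambda>t. x t \<omega>) (\<lambda>t. y t \<omega>) \<and> D (\<lambda>t. x t \<omega>) \<longrightarrow>
          (\<exists>!S\<in>Pow {..n}. (R (\<lambda>t. x t \<omega>) (\<lambda>t. t \<in> S) \<and> D (\<lambda>t. x t \<omega>)) \<and> F S (\<lambda>t. y t \<omega>)))"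
      proof (rule AE_I2)
        fix \<omega>
        show "(\<forall>S\<in>Pow {..n}. (R (\<lambda>t. x t \<omega>) (\<lambda>t. t \<in> S) \<and> D (\<lambda>t. x t \<omega>)) \<and> F S (\<lambda>t. y t \<omega>)
          \<longrightarrow> R (\<lambda>t. x t \<omega>) (\<lambda>t. y t \<omega>) \<and> D (\<lambda>t. x t \<omega>)) \<and>
        (R (\<lambda>t. x t \<omega>) (\<lambda>t. y t \<omega>) \<and> D (\<lambda>t. x t \<omega>) \<longrightarrow>
          (\<exists>!S\<in>Pow {..n}. (R (\<lambda>t. x t \<omega>) (\<lambda>t. t \<in> S) \<and> D (\<lambda>t. x t \<omega>)) \<and> F S (\<lambda>t. y t \<omega>)))"
          using ex[of "\<lambda>t. x t \<omega>" "\<lambda>t. y t \<omega>"] uniq[of _ "\<lambda>t. y t \<omega>"] by blast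
      qed
    qed auto
    also have "\<dots> = (\<Sum>S\<in>Pow {..n}. \<P>(\<omega> in M. R (\<lambda>t. x t \<omega>) (\<lambda>t. t \<in> S) \<and> D (\<lambda>t. x t \<omega>)) * \<P>(\<omega> in M. F S (\<lambda>t. y t \<omega>)))"
    proof (rule sum.cong[OF refl])
      fix S
      have "depends_upto (max n k) (\<lambda>a. R a (\<lambda>t. t \<in> S) \<and> D a)"
        by (intro depends_upto_conj depends_upto_mono[OF R(1)] depends_upto_mono[OF D]) simp_all
      from indep_processesD[OF ind this F[of S]]
      show "\<P>(\<omega> in M. (R (\<lambda>t. x t \<omega>) (\<lambda>t. t \<in> S) \<and> D (\<lambda>t. x t \<omega>)) \<and> F S (\<lambda>t. y t \<omega>)) =
        \<P>(\<omega> in M. R (\<lambda>t. x t \<omega>) (\<lambda>t. t \<in> S) \<and> D (\<lambda>t. x t \<omega>)) * \<P>(\<omega> in M. F S (\<lambda>t. y t \<omega>))" .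
    qed
    finally show ?thesis .
  qed
  have D1: "depends_upto (n + m) (\<lambda>a. a n \<and> C (\<lambda>i. a (n + i)))" using C by simp
  have D2: "depends_upto n (\<lambda>a. a n)" by simp
  have "\<P>(\<omega> in M. R (\<lambda>t. x t \<omega>) (\<lambda>t. y t \<omega>) \<and> x n \<omega> \<and> C (\<lambda>i. x (n + i) \<omega>)) =
    (\<Sum>S\<in>Pow {..n}. \<P>(\<omega> in M. R (\<lambda>t. x t \<omega>) (\<lambda>t. t \<in> S) \<and> x n \<omega>) * \<P>(\<omega> in M. F S (\<lambda>t. y t \<omega>))) *
      \<P>(\<omega> in M. C (\<lambda>t. x t \<omega>))"
    unfolding decomp[OF D1] sum_distrib_right
  proof (rule sum.cong[OF refl])
    fix S
    show "\<P>(\<omega> in M. R (\<lambda>t. x t \<omega>) (\<lambda>t. t \<in> S) \<and> x n \<omega> \<and> C (\<lambda>i. x (n + i) \<omega>)) * \<P>(\<omega> in M. F S (\<lambda>t. y t \<omega>)) =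
      \<P>(\<omega> in M. R (\<lambda>t. x t \<omega>) (\<lambda>t. t \<in> S) \<and> x n \<omega>) * \<P>(\<omega> in M. F S (\<lambda>t. y t \<omega>)) * \<P>(\<omega> in M. C (\<lambda>t. x t \<omega>))"
      by (subst X.renewal[OF R(1) C]) simp
  qed
  then show ?thesis unfolding decomp[OF D2] .
qed

text \<open>Indexing the overlaps by the returns of \<open>y\<close> leaves at most \<open>L + k\<close> terms, each of which
  is small once the index exceeds \<open>J + k\<close>, as the \<open>j\<close>-th return happens at time \<open>j\<close> or later.\<close>

lemma overlap_bound:
  assumes X: "renewal_process M x" and Y: "renewal_process M y" and ind: "indep_processes M x y"
    and J: "\<And>t. t \<ge> J \<Longrightarrow> \<P>(\<omega> in M. x t \<omega>) \<le> e" and e: "e \<ge> 0"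
  shows "(\<Sum>t\<le>T. \<P>(\<omega> in M. cnt t (\<lambda>t. y t \<omega>) < L \<and> x t \<omega> \<and> y (t + k) \<omega>)) \<le> real (J + k) + e * real (L + k)"
proof -
  interpret X: renewal_process M x by fact
  interpret Y: renewal_process M y by fact
  have "(\<Sum>t\<le>T. \<P>(\<omega> in M. cnt t (\<lambda>t. y t \<omega>) < L \<and> x t \<omega> \<and> y (t + k) \<omega>)) \<le>
    (\<Sum>t\<le>T. \<Sum>j<L + k. \<P>(\<omega> in M. hit j (t + k) (\<lambda>t. y t \<omega>)) * X.u t)"
  proof (rule sum_mono)
    fix t
    have "\<P>(\<omega> in M. cnt t (\<lambda>t. y t \<omega>) < L \<and> x t \<omega> \<and> y (t + k) \<omega>) \<le>
      X.prob (\<Union>j<L + k. {\<omega>\<in>space M. x t \<omega> \<and> hit j (t + k) (\<lambda>t. y t \<omega>)})"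
    proof (rule X.finite_measure_mono)
      show "{\<omega>\<in>space M. cnt t (\<lambda>t. y t \<omega>) < L \<and> x t \<omega> \<and> y (t + k) \<omega>} \<subseteq>
        (\<Union>j<L + k. {\<omega>\<in>space M. x t \<omega> \<and> hit j (t + k) (\<lambda>t. y t \<omega>)})"
      proof safe
        fix \<omega> assume \<omega>: "\<omega> \<in> space M" "cnt t (\<lambda>t. y t \<omega>) < L" "x t \<omega>" "y (t + k) \<omega>"
        have "cnt (t + k) (\<lambda>t. y t \<omega>) < L + k"
          using \<omega>(2) cnt_add[of t k "\<lambda>t. y t \<omega>"] cnt_le[of k "\<lambda>i. y (t + i) \<omega>"] by linarith
        then show "\<omega> \<in> (\<Union>j<L + k. {\<omega>\<in>space M. x t \<omega> \<and> hit j (t + k) (\<lambda>t. y t \<omega>)})"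
          using \<omega> by (intro UN_I[of "cnt (t + k) (\<lambda>t. y t \<omega>)"]) (auto simp: hit_def)
      qed
    qed auto
    also have "\<dots> \<le> (\<Sum>j<L + k. \<P>(\<omega> in M. x t \<omega> \<and> hit j (t + k) (\<lambda>t. y t \<omega>)))"
      by (rule X.finite_measure_subadditive_finite) auto
    also have "\<dots> = (\<Sum>j<L + k. \<P>(\<omega> in M. hit j (t + k) (\<lambda>t. y t \<omega>)) * X.u t)"
    proof (rule sum.cong[OF refl])
      fix j
      show "\<P>(\<omega> in M. x t \<omega> \<and> hit j (t + k) (\<lambda>t. y t \<omega>)) = \<P>(\<omega> in M. hit j (t + k) (\<lambda>t. y t \<omega>)) * X.u t"
        using indep_processesD[OF ind, of t "\<lambda>a. a t" "t + k" "hit j (t + k)"] by (simp add: mult.commute)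
    qed
    finally show "\<P>(\<omega> in M. cnt t (\<lambda>t. y t \<omega>) < L \<and> x t \<omega> \<and> y (t + k) \<omega>) \<le>
      (\<Sum>j<L + k. \<P>(\<omega> in M. hit j (t + k) (\<lambda>t. y t \<omega>)) * X.u t)" .
  qed
  also have "\<dots> = (\<Sum>j<L + k. \<Sum>t\<le>T. \<P>(\<omega> in M. hit j (t + k) (\<lambda>t. y t \<omega>)) * X.u t)"
    by (rule sum.swap)
  \<comment> \<open>For fixed \<open>j\<close> the hit probabilities sum to at most 1 over
    \<open>t\<close>, so it is enough to bound the factor \<open>X.u t\<close>. It is at most 1, and
    at most \<open>e\<close> when \<open>j \<ge> J + k\<close>, because then
    \<open>t + k \<ge> j\<close> forces \<open>t \<ge> J\<close>.\<close>
  also have "\<dots> \<le> (\<Sum>j<L + k. of_bool (j < J + k) + e)"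
  proof (rule sum_mono)
    fix j
    let ?c = "of_bool (j < J + k) + e"
    have "(\<Sum>t\<le>T. \<P>(\<omega> in M. hit j (t + k) (\<lambda>t. y t \<omega>)) * X.u t) \<le>
      (\<Sum>t\<le>T. \<P>(\<omega> in M. hit j (t + k) (\<lambda>t. y t \<omega>)) * ?c)"
    proof (rule sum_mono)
      fix t
      show "\<P>(\<omega> in M. hit j (t + k) (\<lambda>t. y t \<omega>)) * X.u t \<le> \<P>(\<omega> in M. hit j (t + k) (\<lambda>t. y t \<omega>)) * ?c"
      proof (cases "j \<le> t + k")
        case True
        have "X.u t \<le> ?c"
        proof (cases "j < J + k")
          case True then show ?thesis using X.prob_le_1[of "{\<omega>\<in>space M. x t \<omega>}"] e by (simp add: add_increasing2)
        next
          case False then show ?thesis using J[of t] \<open>j \<le> t + k\<close> by simp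
        qed
        then show ?thesis by (rule mult_left_mono) simp
      next
        case False
        then have "\<not> hit j (t + k) w" for w using hit_le by blast
        then show ?thesis by simp
      qed
    qed
    also have "\<dots> = (\<Sum>t\<le>T. \<P>(\<omega> in M. hit j (t + k) (\<lambda>t. y t \<omega>))) * ?c"
      by (simp only: sum_distrib_right)
    also have "\<dots> \<le> 1 * ?c"
    proof (rule mult_right_mono)
      have "(\<Sum>t\<le>T. \<P>(\<omega> in M. hit j (t + k) (\<lambda>t. y t \<omega>))) = \<P>(\<omega> in M. \<exists>t\<le>T. hit j (t + k) (\<lambda>t. y t \<omega>))"
        by (rule X.prob_sum[symmetric]) (auto intro!: AE_I2 dest: hit_unique)
      then show "(\<Sum>t\<le>T. \<P>(\<omega> in M. hit j (t + k) (\<lambda>t. y t \<omega>))) \<le> 1" by simp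
    qed (use e in simp)
    finally show "(\<Sum>t\<le>T. \<P>(\<omega> in M. hit j (t + k) (\<lambda>t. y t \<omega>)) * X.u t) \<le> ?c" by simp
  qed
  also have "\<dots> \<le> real (J + k) + e * real (L + k)"
  proof -
    have "(\<Sum>j<L + k. of_bool (j < J + k)) \<le> (\<Sum>j<J + k. 1 :: real)"
    proof -
      have "(\<Sum>j<L + k. of_bool (j < J + k)) = real (card ({..<L + k} \<inter> {..<J + k}))"
        by (simp add: sum.If_cases of_bool_def lessThan_def)
      also have "\<dots> \<le> real (card {..<J + k})" by (intro of_nat_mono card_mono) auto
      finally show ?thesis by simp
    qed
    then show ?thesis by (simp add: sum.distrib mult.commute)
  qed
  finally show ?thesis .
qed

text \<open>Whichever process produces the \<open>i\<close>-th point of the union is itself back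
  \<open>k\<close> steps later with the common probability of \<open>same\<close>. This alone gives
  the lower bound; the only other way to see a one there is that the other process supplies it, and
  the extra sum in the upper bound pays for these cross events.\<close>

lemma union_revisit_bounds:
  assumes X: "renewal_process M x" and Y: "renewal_process M y" and ind: "indep_processes M x y"
    and same: "\<And>t. \<P>(\<omega> in M. x t \<omega>) = \<P>(\<omega> in M. y t \<omega>)"
  defines "z \<equiv> \<lambda>\<omega> t. x t \<omega> \<or> y t \<omega>"
  shows "\<P>(\<omega> in M. \<exists>t\<le>T. hit i t (z \<omega>) \<and> z \<omega> (t + k)) \<ge> \<P>(\<omega> in M. x k \<omega>) * \<P>(\<omega> in M. i \<le> cnt T (\<lambda>t. x t \<omega>))" (is ?lower)
    and "\<P>(\<omega> in M. \<exists>t\<le>T. hit i t (z \<omega>) \<and> z \<omega> (t + k)) \<le> \<P>(\<omega> in M. x k \<omega>) +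
      (\<Sum>t\<le>T. \<P>(\<omega> in M. hit i t (z \<omega>) \<and> x t \<omega> \<and> y (t + k) \<omega>) + \<P>(\<omega> in M. hit i t (z \<omega>) \<and> y t \<omega> \<and> x (t + k) \<omega>))" (is ?upper)
proof -
  interpret X: renewal_process M x by fact
  interpret Y: renewal_process M y by fact
  have ind': "indep_processes M y x" using ind by (rule indep_processes_commute)
  have zm [measurable]: "Measurable.pred M (\<lambda>\<omega>. z \<omega> t)" for t unfolding z_def by measurable
  have hz [measurable]: "Measurable.pred M (\<lambda>\<omega>. hit i t (z \<omega>))" for i t
    using measurable_hit[where M = M and w = "\<lambda>t \<omega>. z \<omega> t" and i = i and t = t] by simp
  define h where "h t = \<P>(\<omega> in M. hit i t (z \<omega>))" for t
  define hx where "hx t = \<P>(\<omega> in M. hit i t (z \<omega>) \<and> x t \<omega>)" for t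
  \<comment> \<open>Excluding \<open>x t\<close> keeps this case disjoint from \<open>hx\<close>;
    the exclusion belongs to the past, so \<open>joint_renewal\<close> still applies to
    \<open>y\<close>.\<close>
  define hy where "hy t = \<P>(\<omega> in M. (hit i t (z \<omega>) \<and> \<not> x t \<omega>) \<and> y t \<omega>)" for t
  have hsplit: "h t = hx t + hy t" for t
  proof -
    have "h t = X.prob ({\<omega>\<in>space M. hit i t (z \<omega>) \<and> x t \<omega>} \<union> {\<omega>\<in>space M. (hit i t (z \<omega>) \<and> \<not> x t \<omega>) \<and> y t \<omega>})"
      unfolding h_def by (intro arg_cong[where f="measure M"]) (auto simp: hit_def z_def)
    also have "\<dots> = hx t + hy t"
      unfolding hx_def hy_def by (rule X.finite_measure_Union) auto
    finally show ?thesis .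
  qed
  have dep: "depends_upto t (\<lambda>a. hit i t (\<lambda>t. a t \<or> b t))" for t and b :: "nat \<Rightarrow> bool"
    by (rule depends_uptoI) (auto intro!: hit_cong)
  have hxk: "\<P>(\<omega> in M. hit i t (z \<omega>) \<and> x t \<omega> \<and> x (t + k) \<omega>) = hx t * X.u k" for t
    unfolding hx_def z_def
    using joint_renewal[OF X Y ind, of t "\<lambda>a b. hit i t (\<lambda>t. a t \<or> b t)" k "\<lambda>a. a k"] dep[of t]
    by (simp add: disj_commute)
  have hyk: "\<P>(\<omega> in M. (hit i t (z \<omega>) \<and> \<not> x t \<omega>) \<and> y t \<omega> \<and> y (t + k) \<omega>) = hy t * X.u k" for t
    unfolding hy_def z_def same
    by (rule joint_renewal[OF Y X ind', of t "\<lambda>b a. hit i t (\<lambda>t. a t \<or> b t) \<and> \<not> a t" k "\<lambda>a. a k"])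
      (use dep[of t] in \<open>simp_all add: disj_commute\<close>)
  have c: "\<P>(\<omega> in M. \<exists>t\<le>T. hit i t (z \<omega>) \<and> z \<omega> (t + k)) = (\<Sum>t\<le>T. \<P>(\<omega> in M. hit i t (z \<omega>) \<and> z \<omega> (t + k)))"
    by (rule X.prob_sum) (auto intro!: AE_I2 dest: hit_unique)
  have sh: "(\<Sum>t\<le>T. h t) = \<P>(\<omega> in M. \<exists>t\<le>T. hit i t (z \<omega>))"
    unfolding h_def by (rule X.prob_sum[symmetric]) (auto intro!: AE_I2 dest: hit_unique)
  have sh_le: "(\<Sum>t\<le>T. h t) \<le> 1" unfolding sh by simp
  \<comment> \<open>The union has at least as many points as \<open>x\<close>, so its
    \<open>i\<close>-th point has come by time \<open>T\<close> whenever that of \<open>x\<close>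
    has.\<close>
  have sh_ge: "\<P>(\<omega> in M. i \<le> cnt T (\<lambda>t. x t \<omega>)) \<le> (\<Sum>t\<le>T. h t)"
    unfolding sh
  proof (rule X.finite_measure_mono_AE)
    show "AE \<omega> in M. \<omega> \<in> {\<omega>\<in>space M. i \<le> cnt T (\<lambda>t. x t \<omega>)} \<longrightarrow> \<omega> \<in> {\<omega>\<in>space M. \<exists>t\<le>T. hit i t (z \<omega>)}"
      using X.w_0
    proof eventually_elim
      case (elim \<omega>)
      have "cnt T (\<lambda>t. x t \<omega>) \<le> cnt T (z \<omega>)" by (rule cnt_mono_seq) (simp add: z_def)
      then show ?case using le_cnt_iff_hit[of "z \<omega>" i T] elim by (auto simp: z_def)
    qed
  qed simp
  have low: "h t * X.u k \<le> \<P>(\<omega> in M. hit i t (z \<omega>) \<and> z \<omega> (t + k))" for t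
  proof -
    have "h t * X.u k = \<P>(\<omega> in M. hit i t (z \<omega>) \<and> x t \<omega> \<and> x (t + k) \<omega>) +
      \<P>(\<omega> in M. (hit i t (z \<omega>) \<and> \<not> x t \<omega>) \<and> y t \<omega> \<and> y (t + k) \<omega>)"
      unfolding hxk hyk hsplit by (simp add: algebra_simps)
    also have "\<dots> = X.prob ({\<omega>\<in>space M. hit i t (z \<omega>) \<and> x t \<omega> \<and> x (t + k) \<omega>} \<union>
      {\<omega>\<in>space M. (hit i t (z \<omega>) \<and> \<not> x t \<omega>) \<and> y t \<omega> \<and> y (t + k) \<omega>})"
      by (rule X.finite_measure_Union[symmetric]) auto
    also have "\<dots> \<le> \<P>(\<omega> in M. hit i t (z \<omega>) \<and> z \<omega> (t + k))"
      by (rule X.finite_measure_mono) (auto simp: z_def)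
    finally show ?thesis .
  qed
  have up: "\<P>(\<omega> in M. hit i t (z \<omega>) \<and> z \<omega> (t + k)) \<le> h t * X.u k +
    (\<P>(\<omega> in M. hit i t (z \<omega>) \<and> x t \<omega> \<and> y (t + k) \<omega>) + \<P>(\<omega> in M. hit i t (z \<omega>) \<and> y t \<omega> \<and> x (t + k) \<omega>))" for t
  proof -
    let ?A = "{\<omega>\<in>space M. hit i t (z \<omega>) \<and> x t \<omega> \<and> x (t + k) \<omega>}"
    let ?B = "{\<omega>\<in>space M. (hit i t (z \<omega>) \<and> \<not> x t \<omega>) \<and> y t \<omega> \<and> y (t + k) \<omega>}"
    let ?C = "{\<omega>\<in>space M. hit i t (z \<omega>) \<and> x t \<omega> \<and> y (t + k) \<omega>}"
    let ?D = "{\<omega>\<in>space M. hit i t (z \<omega>) \<and> y t \<omega> \<and> x (t + k) \<omega>}"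
    have "\<P>(\<omega> in M. hit i t (z \<omega>) \<and> z \<omega> (t + k)) \<le> X.prob ((?A \<union> ?B) \<union> (?C \<union> ?D))"
      by (rule X.finite_measure_mono) (auto simp: z_def hit_def)
    also have "\<dots> \<le> X.prob (?A \<union> ?B) + X.prob (?C \<union> ?D)" by (rule measure_Un_le) auto
    also have "\<dots> \<le> (X.prob ?A + X.prob ?B) + (X.prob ?C + X.prob ?D)"
      by (intro add_mono measure_Un_le) auto
    also have "X.prob ?A + X.prob ?B = h t * X.u k"
      unfolding hxk hyk hsplit by (simp add: algebra_simps)
    finally show ?thesis .
  qed
  have "X.u k * \<P>(\<omega> in M. i \<le> cnt T (\<lambda>t. x t \<omega>)) \<le> X.u k * (\<Sum>t\<le>T. h t)"
    using sh_ge by (rule mult_left_mono) simp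
  also have "\<dots> = (\<Sum>t\<le>T. h t * X.u k)" by (subst mult.commute) (rule sum_distrib_right)
  also have "\<dots> \<le> (\<Sum>t\<le>T. \<P>(\<omega> in M. hit i t (z \<omega>) \<and> z \<omega> (t + k)))" by (rule sum_mono[OF low])
  finally show ?lower unfolding c .
  have "(\<Sum>t\<le>T. h t * X.u k) \<le> X.u k"
  proof -
    have "(\<Sum>t\<le>T. h t * X.u k) = (\<Sum>t\<le>T. h t) * X.u k" by (simp only: sum_distrib_right)
    also have "\<dots> \<le> 1 * X.u k" using sh_le by (rule mult_right_mono) simp
    finally show ?thesis by simp
  qed
  moreover have "(\<Sum>t\<le>T. \<P>(\<omega> in M. hit i t (z \<omega>) \<and> z \<omega> (t + k))) \<le> (\<Sum>t\<le>T. h t * X.u k +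
    (\<P>(\<omega> in M. hit i t (z \<omega>) \<and> x t \<omega> \<and> y (t + k) \<omega>) + \<P>(\<omega> in M. hit i t (z \<omega>) \<and> y t \<omega> \<and> x (t + k) \<omega>)))"
    by (rule sum_mono[OF up])
  ultimately show ?upper unfolding c sum.distrib[of "\<lambda>t. h t * X.u k"] by linarith
qed

text \<open>At a fixed time the events for different \<open>i\<close> are disjoint, and together
  they force fewer than \<open>L\<close> returns of \<open>z\<close>, hence of \<open>y\<close>.
  Summing over \<open>i\<close> thus costs nothing beyond \<open>overlap_bound\<close>.\<close>

lemma sum_overlap_bound:
  assumes X: "renewal_process M x" and Y: "renewal_process M y" and ind: "indep_processes M x y"
    and J: "\<And>t. t \<ge> J \<Longrightarrow> \<P>(\<omega> in M. x t \<omega>) \<le> e" and e: "e \<ge> 0"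
    and z [measurable]: "\<And>t. Measurable.pred M (\<lambda>\<omega>. z \<omega> t)" and yz: "\<And>t \<omega>. y t \<omega> \<Longrightarrow> z \<omega> t"
  shows "(\<Sum>i<L. \<Sum>t\<le>T i. \<P>(\<omega> in M. hit i t (z \<omega>) \<and> x t \<omega> \<and> y (t + k) \<omega>)) \<le> real (J + k) + e * real (L + k)"
proof -
  interpret X: renewal_process M x by fact
  interpret Y: renewal_process M y by fact
  have hz [measurable]: "Measurable.pred M (\<lambda>\<omega>. hit i t (z \<omega>))" for i t
    using measurable_hit[where M = M and w = "\<lambda>t \<omega>. z \<omega> t" and i = i and t = t] by simp
  have cz [measurable]: "(\<lambda>\<omega>. cnt t (z \<omega>)) \<in> measurable M (count_space UNIV)" for t
    using measurable_cnt[where M = M and w = "\<lambda>t \<omega>. z \<omega> t" and t = t] by simp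
  \<comment> \<open>A common horizon above every \<open>T i\<close> with \<open>i < L\<close>, so
    that the two sums can be exchanged.\<close>
  define T' where "T' = (\<Sum>i<L. T i)"
  have T': "T i \<le> T'" if "i < L" for i
    unfolding T'_def using that by (intro member_le_sum) auto
  have "(\<Sum>i<L. \<Sum>t\<le>T i. \<P>(\<omega> in M. hit i t (z \<omega>) \<and> x t \<omega> \<and> y (t + k) \<omega>)) \<le>
    (\<Sum>i<L. \<Sum>t\<le>T'. \<P>(\<omega> in M. hit i t (z \<omega>) \<and> x t \<omega> \<and> y (t + k) \<omega>))"
    using T' by (intro sum_mono sum_mono2) auto
  also have "\<dots> = (\<Sum>t\<le>T'. \<Sum>i<L. \<P>(\<omega> in M. hit i t (z \<omega>) \<and> x t \<omega> \<and> y (t + k) \<omega>))"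
    by (rule sum.swap)
  also have "\<dots> \<le> (\<Sum>t\<le>T'. \<P>(\<omega> in M. cnt t (\<lambda>t. y t \<omega>) < L \<and> x t \<omega> \<and> y (t + k) \<omega>))"
  proof (rule sum_mono)
    fix t
    have "(\<Sum>i<L. \<P>(\<omega> in M. hit i t (z \<omega>) \<and> x t \<omega> \<and> y (t + k) \<omega>)) =
      \<P>(\<omega> in M. \<exists>i<L. hit i t (z \<omega>) \<and> x t \<omega> \<and> y (t + k) \<omega>)"
      by (rule X.prob_sum[symmetric]) (auto intro!: AE_I2 simp: hit_def)
    also have "\<dots> \<le> \<P>(\<omega> in M. cnt t (\<lambda>t. y t \<omega>) < L \<and> x t \<omega> \<and> y (t + k) \<omega>)"
    proof (rule X.finite_measure_mono)
      show "{\<omega>\<in>space M. \<exists>i<L. hit i t (z \<omega>) \<and> x t \<omega> \<and> y (t + k) \<omega>} \<subseteq>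
        {\<omega>\<in>space M. cnt t (\<lambda>t. y t \<omega>) < L \<and> x t \<omega> \<and> y (t + k) \<omega>}"
      proof safe
        fix \<omega> i assume "i < L" "hit i t (z \<omega>)"
        moreover have "cnt t (\<lambda>t. y t \<omega>) \<le> cnt t (z \<omega>)" by (rule cnt_mono_seq) (simp add: yz)
        ultimately show "cnt t (\<lambda>t. y t \<omega>) < L" by (simp add: hit_def)
      qed
    qed simp
    finally show "(\<Sum>i<L. \<P>(\<omega> in M. hit i t (z \<omega>) \<and> x t \<omega> \<and> y (t + k) \<omega>)) \<le>
      \<P>(\<omega> in M. cnt t (\<lambda>t. y t \<omega>) < L \<and> x t \<omega> \<and> y (t + k) \<omega>)" .
  qed
  also have "\<dots> \<le> real (J + k) + e * real (L + k)"
    by (rule overlap_bound[OF X Y ind J e])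
  finally show ?thesis .
qed

text \<open>The cross terms are controlled only on average over \<open>i\<close>, by an arbitrarily
  small multiple of the number of indices plus a constant. Since the limit \<open>v\<close> is
  assumed to exist, the averages converge to it as well and inherit the upper bound; the lower bound
  holds for each \<open>i\<close>.\<close>

lemma union_revisit_limit:
  assumes X: "renewal_process M x" and Y: "renewal_process M y" and ind: "indep_processes M x y"
    and same: "\<And>t. \<P>(\<omega> in M. x t \<omega>) = \<P>(\<omega> in M. y t \<omega>)"
  defines "z \<equiv> \<lambda>\<omega> t. x t \<omega> \<or> y t \<omega>"
  assumes T: "(\<lambda>i. \<P>(\<omega> in M. i \<le> cnt (T i) (\<lambda>t. x t \<omega>))) \<longlonglongrightarrow> 1"
    and lim: "(\<lambda>i. \<P>(\<omega> in M. \<exists>t\<le>T i. hit i t (z \<omega>) \<and> z \<omega> (t + k))) \<longlonglongrightarrow> v"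
  shows "v = \<P>(\<omega> in M. x k \<omega>)"
proof (rule antisym)
  interpret X: renewal_process M x by fact
  interpret Y: renewal_process M y by fact
  have zm [measurable]: "Measurable.pred M (\<lambda>\<omega>. z \<omega> t)" for t unfolding z_def by measurable
  define c where "c i = \<P>(\<omega> in M. \<exists>t\<le>T i. hit i t (z \<omega>) \<and> z \<omega> (t + k))" for i
  define bad where "bad i = (\<Sum>t\<le>T i. \<P>(\<omega> in M. hit i t (z \<omega>) \<and> x t \<omega> \<and> y (t + k) \<omega>) +
    \<P>(\<omega> in M. hit i t (z \<omega>) \<and> y t \<omega> \<and> x (t + k) \<omega>))" for i
  have lower: "X.u k * \<P>(\<omega> in M. i \<le> cnt (T i) (\<lambda>t. x t \<omega>)) \<le> c i" for i
    unfolding c_def z_def by (rule union_revisit_bounds(1)[OF X Y ind same])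
  have upper: "c i \<le> X.u k + bad i" for i
    unfolding c_def bad_def z_def by (rule union_revisit_bounds(2)[OF X Y ind same])
  have c: "c \<longlonglongrightarrow> v" using lim by (simp add: c_def[abs_def])
  from tendsto_mult_left[OF T, of "X.u k"]
  show "X.u k \<le> v" using c lower by (intro LIMSEQ_le[of "\<lambda>i. X.u k * \<P>(\<omega> in M. i \<le> cnt (T i) (\<lambda>t. x t \<omega>))" _ c]) auto
  show "v \<le> X.u k"
  proof (rule field_le_epsilon)
    fix r :: real assume r: "r > 0"
    define e where "e = r / 4"
    have e: "e > 0" using r by (simp add: e_def)
    have "\<forall>\<^sub>F t in sequentially. X.u t < e" using e by (intro order_tendstoD(2)[OF X.null])
    then obtain J where J: "\<And>t. t \<ge> J \<Longrightarrow> X.u t \<le> e" by (auto simp: eventually_sequentially intro: less_imp_le)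
    have J': "\<And>t. t \<ge> J \<Longrightarrow> Y.u t \<le> e" using J same by simp
    have "\<forall>\<^sub>F i in sequentially. v - e < c i" using e by (intro order_tendstoD(1)[OF c]) simp
    then obtain I where I: "\<And>i. i \<ge> I \<Longrightarrow> v - e \<le> c i" by (auto simp: eventually_sequentially intro: less_imp_le)
    \<comment> \<open>The first \<open>I\<close> terms enter only through their nonnegativity and
      contribute a constant on the right; the two overlap sums account for \<open>2 * e\<close> per
      index. As the right side does not depend on \<open>n\<close>, the coefficient of
      \<open>n\<close> on the left cannot be positive.\<close>
    have bound: "real n * (v - e - X.u k - 2 * e) \<le> real I * X.u k + 2 * (real (J + k) + e * real (I + k)) + real I * 2" for n
    proof -
      let ?L = "I + n"
      have "real n * (v - e) = (\<Sum>i\<in>{I..<I + n}. v - e)" by simp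
      also have "\<dots> \<le> (\<Sum>i\<in>{I..<I + n}. c i)" using I by (intro sum_mono) simp
      also have "\<dots> \<le> (\<Sum>i<I + n. c i)" by (intro sum_mono2) (auto simp: c_def)
      also have "\<dots> \<le> (\<Sum>i<I + n. X.u k + bad i)" by (intro sum_mono upper)
      also have "\<dots> = real (I + n) * X.u k + (\<Sum>i<I + n. bad i)" by (simp add: sum.distrib)
      also have "(\<Sum>i<I + n. bad i) \<le> (real (J + k) + e * real (I + n + k)) + (real (J + k) + e * real (I + n + k))"
        unfolding bad_def sum.distrib
        using e by (intro add_mono sum_overlap_bound[OF X Y ind J]
            sum_overlap_bound[OF Y X indep_processes_commute[OF ind] J']) (auto simp: z_def)
      finally show ?thesis by (simp add: algebra_simps)
    qed
    have "v - e - X.u k - 2 * e \<le> 0"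
    proof (rule ccontr)
      assume "\<not> ?thesis"
      then have pos: "v - e - X.u k - 2 * e > 0" by simp
      from reals_Archimedean3[OF this] obtain n :: nat where
        "real I * X.u k + 2 * (real (J + k) + e * real (I + k)) + real I * 2 < real n * (v - e - X.u k - 2 * e)" by blast
      then show False using bound[of n] by simp
    qed
    then show "v \<le> X.u k + r" using r by (simp add: e_def)
  qed
qed

section \<open>Laws on the space of binary sequences\<close>

lemma binary_seq_law:
  fixes w :: "nat \<Rightarrow> 'w \<Rightarrow> bool"
  assumes M: "prob_space M" and w [measurable]: "\<And>t. Measurable.pred M (w t)"
    and N: "N = distr M (seq_space {0, 1 :: nat}) (\<lambda>\<omega> t. of_bool (w t \<omega>))"
  shows "prob_space N" and "sets N = sets (seq_space {0, 1 :: nat})"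
    and "depends_upto n Q \<Longrightarrow> {s \<in> space N. Q (\<lambda>t. s t = 1)} \<in> sets N"
    and "depends_upto n Q \<Longrightarrow> measure N {s \<in> space N. Q (\<lambda>t. s t = 1)} = \<P>(\<omega> in M. Q (\<lambda>t. w t \<omega>))"
proof -
  have f: "(\<lambda>\<omega> t. of_bool (w t \<omega>)) \<in> measurable M (seq_space {0, 1 :: nat})"
  proof (rule measurable_PiM_single')
    fix t :: nat
    have [measurable]: "(of_bool :: bool \<Rightarrow> nat) \<in> measurable (count_space UNIV) (count_space {0, 1})"
      by (auto simp: of_bool_def)
    show "(\<lambda>\<omega>. of_bool (w t \<omega>)) \<in> measurable M (count_space {0, 1 :: nat})" by measurable
  qed (auto simp: of_bool_def split: if_splits)
  show "prob_space N" unfolding N by (rule prob_space.prob_space_distr[OF M f])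
  show "sets N = sets (seq_space {0, 1 :: nat})" by (simp add: N)
  have ev: "{s \<in> space N. Q (\<lambda>t. s t = 1)} \<in> sets N" if "depends_upto n Q" for n Q
  proof -
    have "Measurable.pred (seq_space {0, 1 :: nat}) (\<lambda>s. s t = 1)" for t
    proof -
      have "(\<lambda>s. s t) \<in> measurable (seq_space {0, 1 :: nat}) (count_space {0, 1})"
        by (rule measurable_component_singleton) simp
      then show ?thesis by measurable
    qed
    from measurable_depends_upto[OF this that] show ?thesis by (simp add: N)
  qed
  show "depends_upto n Q \<Longrightarrow> {s \<in> space N. Q (\<lambda>t. s t = 1)} \<in> sets N" by (rule ev)
  assume Q: "depends_upto n Q"
  have "measure N {s \<in> space N. Q (\<lambda>t. s t = 1)} =
    measure M ((\<lambda>\<omega> t. of_bool (w t \<omega>)) -` {s \<in> space N. Q (\<lambda>t. s t = 1)} \<inter> space M)"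
    using ev[OF Q] unfolding N by (subst measure_distr[OF f]) simp_all
  also have "(\<lambda>\<omega> t. of_bool (w t \<omega>)) -` {s \<in> space N. Q (\<lambda>t. s t = 1)} \<inter> space M = {\<omega> \<in> space M. Q (\<lambda>t. w t \<omega>)}"
    using measurable_space[OF f] by (auto simp: N)
  finally show "measure N {s \<in> space N. Q (\<lambda>t. s t = 1)} = \<P>(\<omega> in M. Q (\<lambda>t. w t \<omega>))" .
qed

text \<open>Provides the generator for \<open>mixing_absolutely_continuous\<close>. Finite-horizon
  events are closed under intersection by passing to the larger horizon, and they include the
  single-coordinate events that generate the product.\<close>

lemma binary_seq_space_generator:
  defines "S \<equiv> seq_space {0, 1 :: nat}"
  defines "G \<equiv> {{s \<in> space S. B (\<lambda>t. s t = 1)} | n B. depends_upto n B}"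
  shows "Int_stable G" and "G \<subseteq> Pow (space S)" and "sets S = sigma_sets (space S) G"
proof -
  have G_I: "{s \<in> space S. B (\<lambda>t. s t = 1)} \<in> G" if "depends_upto n B" for n B
    unfolding G_def using that by (intro CollectI exI[of _ n] exI[of _ B]) simp
  show "Int_stable G"
  proof (rule Int_stableI)
    fix a b assume "a \<in> G" "b \<in> G"
    then obtain n B m C where B: "a = {s \<in> space S. B (\<lambda>t. s t = 1)}" "depends_upto n B"
      and C: "b = {s \<in> space S. C (\<lambda>t. s t = 1)}" "depends_upto m C" unfolding G_def by blast
    have "a \<inter> b = {s \<in> space S. B (\<lambda>t. s t = 1) \<and> C (\<lambda>t. s t = 1)}" using B C by auto
    moreover have "depends_upto (max n m) (\<lambda>w. B w \<and> C w)"
      by (intro depends_upto_conj depends_upto_mono[OF B(2)] depends_upto_mono[OF C(2)]) simp_all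
    note G_I[OF this]
    ultimately show "a \<inter> b \<in> G" by (simp only:)
  qed
  show "G \<subseteq> Pow (space S)" unfolding G_def by auto
  have sp: "space S = (\<Pi>\<^sub>E t\<in>UNIV. {0, 1})" by (simp add: S_def space_PiM)
  have "sets S = sigma_sets (space S) {{f \<in> space S. f i \<in> A} | i A. i \<in> UNIV \<and> A \<in> sets (count_space {0, 1})}"
    unfolding S_def sets_PiM_single by (simp add: space_PiM)
  also have "\<dots> = sigma_sets (space S) G"
  proof (rule sigma_sets_eqI)
    fix a assume "a \<in> {{f \<in> space S. f i \<in> A} | i A. i \<in> UNIV \<and> A \<in> sets (count_space {0, 1})}"
    then obtain i A where a: "a = {f \<in> space S. f i \<in> A}" by blast
    \<comment> \<open>Only the values 0 and 1 occur, so membership in \<open>A\<close> is decided by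
      the one bit \<open>s i = 1\<close>.\<close>
    have "s i \<in> A \<longleftrightarrow> (if s i = 1 then 1 \<in> A else 0 \<in> A)" if "s \<in> space S" for s
    proof -
      have "s i = 0 \<or> s i = 1" using PiE_mem[OF that[unfolded sp], of i] by simp
      then show ?thesis by auto
    qed
    then have "a = {s \<in> space S. (if s i = 1 then 1 \<in> A else 0 \<in> A)}" unfolding a by (intro Collect_cong conj_cong) auto
    moreover have "depends_upto i (\<lambda>w. if w i then 1 \<in> A else 0 \<in> A)"
      by (rule depends_uptoI) simp
    note G_I[OF this]
    ultimately have "a \<in> G" by (simp only:)
    then show "a \<in> sigma_sets (space S) G" by (rule sigma_sets.Basic)
  next
    fix b assume "b \<in> G"
    then obtain n B where b: "b = {s \<in> space S. B (\<lambda>t. s t = 1)}" "depends_upto n B" unfolding G_def by blast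
    have "Measurable.pred S (\<lambda>s. s t = 1)" for t
    proof -
      have "(\<lambda>s. s t) \<in> measurable S (count_space {0, 1})"
        unfolding S_def by (rule measurable_component_singleton) simp
      then show ?thesis by measurable
    qed
    from measurable_depends_upto[OF this b(2)] have "b \<in> sets S" unfolding b by simp
    then show "b \<in> sigma_sets (space S) {{f \<in> space S. f i \<in> A} | i A. i \<in> UNIV \<and> A \<in> sets (count_space {0, 1})}"
      by (simp add: calculation)
  qed
  finally show "sets S = sigma_sets (space S) G" .
qed

section \<open>The contradiction for renewal processes\<close>

text \<open>The theorem with the graphs removed: the revisit events identify the three return laws,
  after which the counting events tell one process from the union of two.\<close>

lemma renewal_union_not_absolutely_continuous:
  fixes x y :: "nat \<Rightarrow> 'w \<Rightarrow> bool" and w :: "nat \<Rightarrow> 'v \<Rightarrow> bool"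
  assumes X: "renewal_process M x" and Y: "renewal_process M y" and ind: "indep_processes M x y"
    and same: "\<And>t. \<P>(\<omega> in M. x t \<omega>) = \<P>(\<omega> in M. y t \<omega>)"
    and W: "renewal_process M' w"
    and \<mu>: "\<mu> = distr M (seq_space {0, 1 :: nat}) (\<lambda>\<omega> t. of_bool (x t \<omega> \<or> y t \<omega>))"
    and \<nu>: "\<nu> = distr M' (seq_space {0, 1 :: nat}) (\<lambda>\<omega> t. of_bool (w t \<omega>))"
  shows "\<not> absolutely_continuous \<nu> \<mu>"
proof
  assume ac: "absolutely_continuous \<nu> \<mu>"
  interpret X: renewal_process M x by fact
  interpret Y: renewal_process M y by fact
  interpret W: renewal_process M' w by fact
  define z where "z t \<omega> \<longleftrightarrow> x t \<omega> \<or> y t \<omega>" for t \<omega>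
  have z [measurable]: "Measurable.pred M (z t)" for t unfolding z_def by measurable
  have \<mu>z: "\<mu> = distr M (seq_space {0, 1 :: nat}) (\<lambda>\<omega> t. of_bool (z t \<omega>))"
    unfolding \<mu> z_def ..
  note law_\<mu> = binary_seq_law[OF X.prob_space_axioms z \<mu>z]
  note law_\<nu> = binary_seq_law[OF W.prob_space_axioms W.w_meas \<nu>]
  have sp: "space \<mu> = space (seq_space {0, 1 :: nat})" "space \<nu> = space (seq_space {0, 1 :: nat})"
    using sets_eq_imp_space_eq[OF law_\<mu>(2)] sets_eq_imp_space_eq[OF law_\<nu>(2)] by simp_all
  \<comment> \<open>\<open>mixing_absolutely_continuous\<close> restated for predicates on the
    underlying processes. It is applied twice, to revisit events and to counting events.\<close>
  have transfer: "(\<lambda>i. \<P>(\<omega> in M. Q i (\<lambda>t. z t \<omega>)) - \<P>(\<omega> in M'. Q i (\<lambda>t. w t \<omega>))) \<longlonglongrightarrow> 0"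
    if Q: "\<And>i. depends_upto (d i) (Q i)"
      and mix: "\<And>n B. depends_upto n B \<Longrightarrow> (\<lambda>i. \<P>(\<omega> in M'. Q i (\<lambda>t. w t \<omega>) \<and> B (\<lambda>t. w t \<omega>)) -
        \<P>(\<omega> in M'. Q i (\<lambda>t. w t \<omega>)) * \<P>(\<omega> in M'. B (\<lambda>t. w t \<omega>))) \<longlonglongrightarrow> 0"
    for d and Q :: "nat \<Rightarrow> (nat \<Rightarrow> bool) \<Rightarrow> bool"
  proof -
    define A where "A i = {s \<in> space \<nu>. Q i (\<lambda>t. s t = 1)}" for i
    have nuA: "measure \<nu> (A i) = \<P>(\<omega> in M'. Q i (\<lambda>t. w t \<omega>))" for i
      unfolding A_def by (rule law_\<nu>(4)[OF Q])
    have muA: "measure \<mu> (A i) = \<P>(\<omega> in M. Q i (\<lambda>t. z t \<omega>))" for i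
      using law_\<mu>(4)[OF Q] by (simp only: A_def sp)
    have "(\<lambda>i. measure \<mu> (A i) - measure \<nu> (A i)) \<longlonglongrightarrow> 0"
    proof (rule mixing_absolutely_continuous[OF law_\<nu>(1) law_\<mu>(1) ac])
      show "sets \<mu> = sets \<nu>" using law_\<mu>(2) law_\<nu>(2) by simp
      show "Int_stable {{s \<in> space \<nu>. B (\<lambda>t. s t = 1)} | n B. depends_upto n B}"
        "{{s \<in> space \<nu>. B (\<lambda>t. s t = 1)} | n B. depends_upto n B} \<subseteq> Pow (space \<nu>)"
        "sets \<nu> = sigma_sets (space \<nu>) {{s \<in> space \<nu>. B (\<lambda>t. s t = 1)} | n B. depends_upto n B}"
        unfolding sp law_\<nu>(2) by (rule binary_seq_space_generator)+
      show "A i \<in> sets \<nu>" for i unfolding A_def by (rule law_\<nu>(3)[OF Q])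
      fix b assume "b \<in> {{s \<in> space \<nu>. B (\<lambda>t. s t = 1)} | n B. depends_upto n B}"
      then obtain n B where b: "b = {s \<in> space \<nu>. B (\<lambda>t. s t = 1)}" and B: "depends_upto n B" by blast
      have "measure \<nu> (A i \<inter> b) = \<P>(\<omega> in M'. Q i (\<lambda>t. w t \<omega>) \<and> B (\<lambda>t. w t \<omega>))" for i
      proof -
        have "A i \<inter> b = {s \<in> space \<nu>. Q i (\<lambda>t. s t = 1) \<and> B (\<lambda>t. s t = 1)}" unfolding A_def b by blast
        moreover have "depends_upto (max (d i) n) (\<lambda>w. Q i w \<and> B w)"
          by (intro depends_upto_conj depends_upto_mono[OF Q] depends_upto_mono[OF B]) simp_all
        note law_\<nu>(4)[OF this]
        ultimately show ?thesis by (simp only:)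
      qed
      moreover have "measure \<nu> b = \<P>(\<omega> in M'. B (\<lambda>t. w t \<omega>))" unfolding b by (rule law_\<nu>(4)[OF B])
      ultimately show "(\<lambda>i. measure \<nu> (A i \<inter> b) - measure \<nu> (A i) * measure \<nu> b) \<longlonglongrightarrow> 0"
        using mix[OF B] by (simp only: nuA)
    qed
    then show ?thesis by (simp only: nuA muA)
  qed
  have u_eq: "X.u k = W.u k" for k
  proof -
    \<comment> \<open>One time must serve both processes: for \<open>w\<close> it makes the revisit
      events mix, for \<open>x\<close> it makes the lower bound for the union sharp.\<close>
    have "\<exists>T. \<P>(\<omega> in M. i \<le> cnt T (\<lambda>t. x t \<omega>)) > 1 - inverse (real (Suc i)) \<and>
        \<P>(\<omega> in M'. i \<le> cnt T (\<lambda>t. w t \<omega>)) > 1 - inverse (real (Suc i))" for i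
    proof -
      have pos: "inverse (real (Suc i)) > 0" by simp
      obtain T1 where "\<forall>T\<ge>T1. \<P>(\<omega> in M. i \<le> cnt T (\<lambda>t. x t \<omega>)) > 1 - inverse (real (Suc i))"
        using X.cnt_recurrent[OF pos] by blast
      moreover obtain T2 where "\<forall>T\<ge>T2. \<P>(\<omega> in M'. i \<le> cnt T (\<lambda>t. w t \<omega>)) > 1 - inverse (real (Suc i))"
        using W.cnt_recurrent[OF pos] by blast
      ultimately show ?thesis by (intro exI[of _ "max T1 T2"]) simp
    qed
    then have "\<exists>T. \<forall>i. \<P>(\<omega> in M. i \<le> cnt (T i) (\<lambda>t. x t \<omega>)) > 1 - inverse (real (Suc i)) \<and>
        \<P>(\<omega> in M'. i \<le> cnt (T i) (\<lambda>t. w t \<omega>)) > 1 - inverse (real (Suc i))"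
      by (intro choice allI)
    then obtain T where T: "\<And>i. \<P>(\<omega> in M. i \<le> cnt (T i) (\<lambda>t. x t \<omega>)) > 1 - inverse (real (Suc i))"
        "\<And>i. \<P>(\<omega> in M'. i \<le> cnt (T i) (\<lambda>t. w t \<omega>)) > 1 - inverse (real (Suc i))" by auto
    have lim1: "(\<lambda>i. 1 - inverse (real (Suc i))) \<longlonglongrightarrow> 1"
      using tendsto_diff[OF tendsto_const LIMSEQ_inverse_real_of_nat, of 1] by simp
    have TX: "(\<lambda>i. \<P>(\<omega> in M. i \<le> cnt (T i) (\<lambda>t. x t \<omega>))) \<longlonglongrightarrow> 1"
      by (rule tendsto_sandwich[OF always_eventually[OF allI[OF less_imp_le[OF T(1)]]]
            always_eventually[OF allI] lim1 tendsto_const]) simp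
    have TW: "(\<lambda>i. \<P>(\<omega> in M'. i \<le> cnt (T i) (\<lambda>t. w t \<omega>))) \<longlonglongrightarrow> 1"
      by (rule tendsto_sandwich[OF always_eventually[OF allI[OF less_imp_le[OF T(2)]]]
            always_eventually[OF allI] lim1 tendsto_const]) simp
    define Q where "Q i w \<longleftrightarrow> (\<exists>t\<in>{..T i}. hit i t w \<and> w (t + k))" for i and w :: "nat \<Rightarrow> bool"
    have Q: "depends_upto (T i + k) (Q i)" for i
      unfolding Q_def[abs_def] by (intro depends_upto_Bex depends_upto_conj) simp_all
    have revisit: "(\<lambda>i. \<P>(\<omega> in M'. Q i (\<lambda>t. w t \<omega>) \<and> B (\<lambda>t. w t \<omega>))) \<longlonglongrightarrow> W.u k * \<P>(\<omega> in M'. B (\<lambda>t. w t \<omega>))"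
      if "depends_upto n B" for n B
      using W.mixing_revisit[OF that TW, of k] by (simp add: Q_def Bex_def)
    have revisit1: "(\<lambda>i. \<P>(\<omega> in M'. Q i (\<lambda>t. w t \<omega>))) \<longlonglongrightarrow> W.u k"
      using revisit[of 0 "\<lambda>_. True"] W.prob_space by simp
    have "(\<lambda>i. \<P>(\<omega> in M. Q i (\<lambda>t. z t \<omega>)) - \<P>(\<omega> in M'. Q i (\<lambda>t. w t \<omega>))) \<longlonglongrightarrow> 0"
    proof (rule transfer[OF Q])
      fix n B assume "depends_upto n B"
      from tendsto_diff[OF revisit[OF this] tendsto_mult_right[OF revisit1, of "\<P>(\<omega> in M'. B (\<lambda>t. w t \<omega>))"]]
      show "(\<lambda>i. \<P>(\<omega> in M'. Q i (\<lambda>t. w t \<omega>) \<and> B (\<lambda>t. w t \<omega>)) -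
        \<P>(\<omega> in M'. Q i (\<lambda>t. w t \<omega>)) * \<P>(\<omega> in M'. B (\<lambda>t. w t \<omega>))) \<longlonglongrightarrow> 0" by simp
    qed
    from tendsto_add[OF this revisit1]
    have "(\<lambda>i. \<P>(\<omega> in M. \<exists>t\<le>T i. hit i t (\<lambda>t. x t \<omega> \<or> y t \<omega>) \<and> (x (t + k) \<omega> \<or> y (t + k) \<omega>))) \<longlonglongrightarrow> W.u k"
      by (simp add: Q_def Bex_def z_def)
    from union_revisit_limit[OF X Y ind same TX this] show ?thesis by simp
  qed
  obtain T where T: "\<And>m. m \<le> T m" and
    mid: "\<forall>\<^sub>F m in sequentially. \<P>(\<omega> in M'. m \<le> cnt (T m) (\<lambda>t. w t \<omega>)) \<in> {1 / 4..1 / 2}"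
    using W.intermediate_count by blast
  define p where "p m = \<P>(\<omega> in M'. m \<le> cnt (T m) (\<lambda>t. w t \<omega>))" for m
  have px: "\<P>(\<omega> in M. m \<le> cnt (T m) (\<lambda>t. x t \<omega>)) = p m" for m
    unfolding p_def by (rule cnt_law_determined[OF X W u_eq])
  have py: "\<P>(\<omega> in M. m \<le> cnt (T m) (\<lambda>t. y t \<omega>)) = p m" for m
    unfolding p_def by (rule cnt_law_determined[OF Y W]) (simp add: u_eq same[symmetric])
  have lim: "(\<lambda>m. \<P>(\<omega> in M. m \<le> cnt (T m) (\<lambda>t. z t \<omega>)) - p m) \<longlonglongrightarrow> 0"
    unfolding p_def
    by (rule transfer[of T "\<lambda>m w. m \<le> cnt (T m) w"]) (simp, rule W.mixing_count[OF _ T])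
  \<comment> \<open>The right side is \<open>1 - (1 - p m) * (1 - p m)\<close>, the probability that
    at least one of the independent processes reaches level \<open>m\<close> alone.\<close>
  have big: "\<P>(\<omega> in M. m \<le> cnt (T m) (\<lambda>t. z t \<omega>)) \<ge> 2 * p m - p m * p m" for m
  proof -
    let ?A = "{\<omega>\<in>space M. m \<le> cnt (T m) (\<lambda>t. x t \<omega>)}" and ?B = "{\<omega>\<in>space M. m \<le> cnt (T m) (\<lambda>t. y t \<omega>)}"
    have "?A \<inter> ?B = {\<omega>\<in>space M. m \<le> cnt (T m) (\<lambda>t. x t \<omega>) \<and> m \<le> cnt (T m) (\<lambda>t. y t \<omega>)}" by auto
    then have "X.prob (?A \<inter> ?B) = p m * p m"
      using indep_processesD[OF ind, of "T m" "\<lambda>w. m \<le> cnt (T m) w" "T m" "\<lambda>w. m \<le> cnt (T m) w"] by (simp add: px py)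
    moreover have "X.prob (?A \<union> ?B) = X.prob ?A + X.prob ?B - X.prob (?A \<inter> ?B)"
      by (rule measure_Un3) (auto simp: X.fmeasurable_eq_sets)
    moreover have "X.prob (?A \<union> ?B) \<le> \<P>(\<omega> in M. m \<le> cnt (T m) (\<lambda>t. z t \<omega>))"
    proof (rule X.finite_measure_mono)
      have "cnt (T m) (\<lambda>t. x t \<omega>) \<le> cnt (T m) (\<lambda>t. z t \<omega>)" "cnt (T m) (\<lambda>t. y t \<omega>) \<le> cnt (T m) (\<lambda>t. z t \<omega>)" for \<omega>
        by (auto intro!: cnt_mono_seq simp: z_def)
      then show "?A \<union> ?B \<subseteq> {\<omega>\<in>space M. m \<le> cnt (T m) (\<lambda>t. z t \<omega>)}" by (auto intro: order_trans)
    qed simp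
    ultimately show ?thesis by (simp add: px py)
  qed
  \<comment> \<open>The excess over \<open>p m\<close> is at least \<open>p m * (1 - p m)\<close>,
    which is at least 1/8 for \<open>p m\<close> between 1/4 and 1/2; any constant below 1/8
    contradicts this.\<close>
  have "\<forall>\<^sub>F m in sequentially. \<P>(\<omega> in M. m \<le> cnt (T m) (\<lambda>t. z t \<omega>)) - p m < 1 / 16"
    by (intro order_tendstoD(2)[OF lim]) simp
  then have "\<forall>\<^sub>F m in sequentially. False"
    using mid
  proof eventually_elim
    case (elim m)
    then have "1 / 4 \<le> p m" "p m \<le> 1 / 2" by (simp_all add: p_def)
    moreover from this have "1 / 4 * (1 - 1 / 2) \<le> p m * (1 - p m)" by (intro mult_mono) auto
    ultimately show ?case using elim(1) big[of m] by (simp add: algebra_simps)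
  qed
  then show False by simp
qed

section \<open>Path probabilities and the renewal structure of a random walk\<close>

text \<open>The closed ball rather than the set of exact endpoints: one finite set then contains
  almost surely the whole history up to time \<open>n\<close>, and events become finite sums over
  paths.\<close>

fun reach :: "('a \<times> 'a) set \<Rightarrow> 'a \<Rightarrow> nat \<Rightarrow> 'a set" where
  "reach E v 0 = {v}"
| "reach E v (Suc n) = reach E v n \<union> E `` reach E v n"

locale random_walk = prob_space M for M :: "'w measure" +
  fixes V :: "'a set" and E and v and X :: "nat \<Rightarrow> 'w \<Rightarrow> 'a"
  assumes simple: "simple_graph V E" and inf: "infinite V" and con: "connected_graph V E"
    and lf: "locally_finite_graph V E" and v: "v \<in> V"
    and walk: "simple_random_walk V E v M X"
begin

definition p :: "'a \<Rightarrow> 'a \<Rightarrow> real" where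
  "p a b = pmf (pmf_of_set (E `` {a})) b"

definition H :: "nat \<Rightarrow> (nat \<Rightarrow> 'a) \<Rightarrow> real" where
  "H n x = \<P>(\<omega> in M. \<forall>i\<le>n. X i \<omega> = x i)"

lemma EV: "E \<subseteq> V \<times> V" and symE: "sym E"
  using simple by (auto simp: simple_graph_def)

lemma finite_nbrs: "a \<in> V \<Longrightarrow> finite (E `` {a})"
  using lf by (auto simp: locally_finite_graph_def)

lemma nbrs_nonempty: "a \<in> V \<Longrightarrow> E `` {a} \<noteq> {}"
  by (rule connected_graph_nbrs_nonempty[OF con inf])

lemma p_eq: "a \<in> V \<Longrightarrow> p a b = of_bool (b \<in> E `` {a}) / real (card (E `` {a}))"
  unfolding p_def by (subst pmf_of_set) (auto simp: finite_nbrs nbrs_nonempty indicator_def)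

lemma finite_reach: "finite (reach E v n)" and reach_V: "reach E v n \<subseteq> V"
proof -
  have "finite (reach E v n) \<and> reach E v n \<subseteq> V"
  proof (induction n)
    case (Suc n)
    have "finite (E `` reach E v n)"
      using Suc finite_nbrs by (subst Image_eq_UN) blast
    then show ?case using Suc EV by auto
  qed (use v in simp)
  then show "finite (reach E v n)" "reach E v n \<subseteq> V" by auto
qed

lemma X_meas: "X t \<in> measurable M (count_space V)"
  using walk by (simp add: simple_random_walk_def)

lemma X_pred [measurable]: "Measurable.pred M (\<lambda>\<omega>. X t \<omega> = a)" "Measurable.pred M (\<lambda>\<omega>. X t \<omega> \<in> A)"
  by (rule measurable_compose[OF X_meas], simp)+

lemma X_0: "AE \<omega> in M. X 0 \<omega> = v"
  using walk by (simp add: simple_random_walk_def)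

text \<open>The walk condition without conditioning. It also covers histories of probability 0,
  about which the definition of the walk says nothing; there both sides vanish.\<close>

lemma history_step:
  "\<P>(\<omega> in M. (\<forall>i\<le>n. X i \<omega> = x i) \<and> X (Suc n) \<omega> = y) = H n x * p (x n) y"
proof (cases "H n x > 0")
  case True
  then have "\<P>(\<omega> in M. X (Suc n) \<omega> = y \<bar> \<forall>i\<le>n. X i \<omega> = x i) = p (x n) y"
    using walk unfolding simple_random_walk_def H_def p_def by blast
  then have "\<P>(\<omega> in M. X (Suc n) \<omega> = y \<and> (\<forall>i\<le>n. X i \<omega> = x i)) = H n x * p (x n) y"
    using True unfolding cond_prob_def H_def by (simp add: field_simps)
  then show ?thesis by (subst conj_commute)
next
  case False
  moreover have "H n x \<ge> 0" by (simp add: H_def)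
  ultimately have "H n x = 0" by linarith
  moreover have "\<P>(\<omega> in M. (\<forall>i\<le>n. X i \<omega> = x i) \<and> X (Suc n) \<omega> = y) \<le> H n x"
    unfolding H_def by (rule finite_measure_mono) auto
  ultimately show ?thesis by (simp add: order_antisym)
qed

lemma H_0: "H 0 x = of_bool (x 0 = v)"
proof (cases "x 0 = v")
  case True
  have "\<P>(\<omega> in M. X 0 \<omega> = v) = 1" 
    using prob_Collect_eq_1[OF predE[OF X_pred(1)]] X_0 by blast
  then show ?thesis using True unfolding H_def by simp
next
  case False
  have "AE \<omega> in M. X 0 \<omega> \<noteq> x 0" using X_0 by eventually_elim (use False in auto)
  then have "\<P>(\<omega> in M. X 0 \<omega> = x 0) = 0"
    using prob_Collect_eq_0[OF predE[OF X_pred(1)]] by blast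
  then show ?thesis using False unfolding H_def by simp
qed

lemma H_Suc: "H (Suc n) x = H n x * p (x n) (x (Suc n))"
proof -
  have "H (Suc n) x = \<P>(\<omega> in M. (\<forall>i\<le>n. X i \<omega> = x i) \<and> X (Suc n) \<omega> = x (Suc n))"
    unfolding H_def by (intro arg_cong[where f="measure M"] Collect_cong) (auto simp: le_Suc_eq)
  then show ?thesis by (simp add: history_step)
qed

text \<open>Path probabilities are products of transition probabilities, so a path through
  \<open>v\<close> at time \<open>n\<close> factorises there. If \<open>c\<close> does not start at
  \<open>v\<close>, the event is empty and \<open>H m c\<close> is 0.\<close>

lemma history_restart:
  assumes "x n = v"
  shows "\<P>(\<omega> in M. (\<forall>i\<le>n. X i \<omega> = x i) \<and> (\<forall>i\<le>m. X (n + i) \<omega> = c i)) = H n x * H m c"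
proof (cases "c 0 = v")
  case True
  \<comment> \<open>The concatenated path. Both pieces contain time \<open>n\<close>, where they
    agree because \<open>x n\<close> and \<open>c 0\<close> both equal \<open>v\<close>.\<close>
  define g where "g j = (if j \<le> n then x j else c (j - n))" for j
  have gc: "g (n + i) = c i" for i using True assms by (cases i) (auto simp: g_def)
  have "\<P>(\<omega> in M. (\<forall>i\<le>n. X i \<omega> = x i) \<and> (\<forall>i\<le>m. X (n + i) \<omega> = c i)) = H (n + m) g"
    unfolding H_def
  proof (intro arg_cong[where f="measure M"] Collect_cong conj_cong refl iffI allI impI)
    fix \<omega> j assume h: "(\<forall>i\<le>n. X i \<omega> = x i) \<and> (\<forall>i\<le>m. X (n + i) \<omega> = c i)" and j: "j \<le> n + m"
    show "X j \<omega> = g j"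
    proof (cases "j \<le> n")
      case False
      then have "j = n + (j - n)" "j - n \<le> m" using j by auto
      then show ?thesis using h gc by metis
    qed (use h in \<open>simp add: g_def\<close>)
  next
    fix \<omega> assume h: "\<forall>j\<le>n + m. X j \<omega> = g j"
    have "X i \<omega> = x i" if "i \<le> n" for i using h that by (simp add: g_def)
    moreover have "X (n + i) \<omega> = c i" if "i \<le> m" for i using h that gc by simp
    ultimately show "(\<forall>i\<le>n. X i \<omega> = x i) \<and> (\<forall>i\<le>m. X (n + i) \<omega> = c i)" by blast
  qed
  also have "H (n + m) g = H n x * H m c"
  proof (induction m)
    case 0
    have "H n g = H n x" unfolding H_def by (intro arg_cong[where f="measure M"] Collect_cong) (simp add: g_def)
    then show ?case using True by (simp add: H_0)
  next
    case (Suc m)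
    then show ?case using gc[of m] gc[of "Suc m"] by (simp add: H_Suc)
  qed
  finally show ?thesis .
next
  case False
  have "H m c = 0"
    by (induction m) (simp_all add: H_0 H_Suc False)
  moreover have "{\<omega>\<in>space M. (\<forall>i\<le>n. X i \<omega> = x i) \<and> (\<forall>i\<le>m. X (n + i) \<omega> = c i)} = {}"
    using False assms by fastforce
  ultimately show ?thesis by (simp del: Collect_empty_eq)
qed

text \<open>The transition probabilities to the finitely many neighbours already add up to 1, so
  nothing is left for other vertices.\<close>

lemma AE_step:
  assumes "x n \<in> V"
  shows "AE \<omega> in M. (\<forall>i\<le>n. X i \<omega> = x i) \<longrightarrow> X (Suc n) \<omega> \<in> E `` {x n}"
proof -
  have "\<P>(\<omega> in M. (\<forall>i\<le>n. X i \<omega> = x i) \<and> X (Suc n) \<omega> \<in> E `` {x n}) =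
    (\<Sum>y\<in>E `` {x n}. \<P>(\<omega> in M. (\<forall>i\<le>n. X i \<omega> = x i) \<and> X (Suc n) \<omega> = y))"
  proof (rule prob_sum)
    show "AE \<omega> in M. (\<forall>y\<in>E `` {x n}. (\<forall>i\<le>n. X i \<omega> = x i) \<and> X (Suc n) \<omega> = y \<longrightarrow>
        (\<forall>i\<le>n. X i \<omega> = x i) \<and> X (Suc n) \<omega> \<in> E `` {x n}) \<and>
      ((\<forall>i\<le>n. X i \<omega> = x i) \<and> X (Suc n) \<omega> \<in> E `` {x n} \<longrightarrow>
        (\<exists>!y\<in>E `` {x n}. (\<forall>i\<le>n. X i \<omega> = x i) \<and> X (Suc n) \<omega> = y))"
      by (rule AE_I2) blast
  qed (rule finite_nbrs[OF assms], measurable)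
  also have "\<dots> = H n x * (\<Sum>y\<in>E `` {x n}. p (x n) y)"
    by (simp add: history_step sum_distrib_left)
  also have "(\<Sum>y\<in>E `` {x n}. p (x n) y) = 1"
    using finite_nbrs[OF assms] nbrs_nonempty[OF assms] by (simp add: p_eq[OF assms])
  finally have eq: "\<P>(\<omega> in M. (\<forall>i\<le>n. X i \<omega> = x i) \<and> X (Suc n) \<omega> \<in> E `` {x n}) = H n x" by simp
  have "\<P>(\<omega> in M. \<not> ((\<forall>i\<le>n. X i \<omega> = x i) \<longrightarrow> X (Suc n) \<omega> \<in> E `` {x n})) =
    prob ({\<omega>\<in>space M. \<forall>i\<le>n. X i \<omega> = x i} - {\<omega>\<in>space M. (\<forall>i\<le>n. X i \<omega> = x i) \<and> X (Suc n) \<omega> \<in> E `` {x n}})"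
    by (intro arg_cong[where f="measure M"]) blast
  also have "\<dots> = 0"
  proof (subst finite_measure_Diff)
    show "\<P>(\<omega> in M. \<forall>i\<le>n. X i \<omega> = x i) - \<P>(\<omega> in M. (\<forall>i\<le>n. X i \<omega> = x i) \<and> X (Suc n) \<omega> \<in> E `` {x n}) = 0"
      using eq unfolding H_def by simp
    show "{\<omega>\<in>space M. (\<forall>i\<le>n. X i \<omega> = x i) \<and> X (Suc n) \<omega> \<in> E `` {x n}} \<subseteq> {\<omega>\<in>space M. \<forall>i\<le>n. X i \<omega> = x i}"
      by blast
  qed measurable
  finally have "AE \<omega> in M. \<not> \<not> ((\<forall>i\<le>n. X i \<omega> = x i) \<longrightarrow> X (Suc n) \<omega> \<in> E `` {x n})"
    by (subst (asm) prob_Collect_eq_0) measurable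
  then show ?thesis by (simp only: not_not)
qed

lemma AE_reach: "AE \<omega> in M. \<forall>i\<le>n. X i \<omega> \<in> reach E v n"
proof (induction n)
  case 0
  show ?case using X_0 by eventually_elim simp
next
  case (Suc n)
  have fin: "finite (PiE {..n} (\<lambda>_. reach E v n))" by (intro finite_PiE) (simp_all add: finite_reach)
  have "AE \<omega> in M. \<forall>x\<in>PiE {..n} (\<lambda>_. reach E v n). (\<forall>i\<le>n. X i \<omega> = x i) \<longrightarrow> X (Suc n) \<omega> \<in> E `` {x n}"
    using reach_V by (intro AE_finite_allI[OF fin] AE_step) (auto simp: PiE_iff)
  then show ?case using Suc
  proof eventually_elim
    case (elim \<omega>)
    define x where "x = restrict (\<lambda>i. X i \<omega>) {..n}"
    have "x \<in> PiE {..n} (\<lambda>_. reach E v n)" "\<forall>i\<le>n. X i \<omega> = x i" using elim(2) by (auto simp: x_def)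
    then have "X (Suc n) \<omega> \<in> E `` {x n}" "x n \<in> reach E v n" using elim(1) by (auto simp: PiE_iff)
    then show ?case using elim(2) by (auto simp: le_Suc_eq)
  qed
qed

text \<open>Almost surely the observed stretch of the walk is one of finitely many paths in the
  ball. Taking paths in \<open>PiE\<close>, which are \<open>undefined\<close> outside
  \<open>{..n}\<close>, makes the path unique and the events disjoint.\<close>

lemma history_decomposition:
  assumes R: "\<And>x x'. (\<And>i. i \<le> n \<Longrightarrow> x i = x' i) \<Longrightarrow> R x = R x'"
    and mR: "Measurable.pred M (\<lambda>\<omega>. R (\<lambda>i. X (k + i) \<omega>))" and mS [measurable]: "Measurable.pred M S"
    and N: "k + n \<le> N"
  shows "\<P>(\<omega> in M. S \<omega> \<and> R (\<lambda>i. X (k + i) \<omega>)) =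
    (\<Sum>x | x \<in> PiE {..n} (\<lambda>_. reach E v N) \<and> R x. \<P>(\<omega> in M. S \<omega> \<and> (\<forall>i\<le>n. X (k + i) \<omega> = x i)))"
proof (rule prob_sum)
  show "finite {x. x \<in> PiE {..n} (\<lambda>_. reach E v N) \<and> R x}"
    by (rule finite_subset[of _ "PiE {..n} (\<lambda>_. reach E v N)"]) (auto intro!: finite_PiE simp: finite_reach)
  show "{\<omega>\<in>space M. S \<omega> \<and> R (\<lambda>i. X (k + i) \<omega>)} \<in> sets M"
    using mR mS by simp
  show "AE \<omega> in M. (\<forall>x\<in>{x. x \<in> PiE {..n} (\<lambda>_. reach E v N) \<and> R x}.
        S \<omega> \<and> (\<forall>i\<le>n. X (k + i) \<omega> = x i) \<longrightarrow> S \<omega> \<and> R (\<lambda>i. X (k + i) \<omega>)) \<and>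
      (S \<omega> \<and> R (\<lambda>i. X (k + i) \<omega>) \<longrightarrow>
        (\<exists>!x\<in>{x. x \<in> PiE {..n} (\<lambda>_. reach E v N) \<and> R x}. S \<omega> \<and> (\<forall>i\<le>n. X (k + i) \<omega> = x i)))"
    using AE_reach[of N]
  proof eventually_elim
    case (elim \<omega>)
    define y where "y = restrict (\<lambda>i. X (k + i) \<omega>) {..n}"
    have y: "y \<in> PiE {..n} (\<lambda>_. reach E v N)" "\<forall>i\<le>n. X (k + i) \<omega> = y i" using elim N by (auto simp: y_def)
    have R': "R x = R (\<lambda>i. X (k + i) \<omega>)" if "\<forall>i\<le>n. X (k + i) \<omega> = x i" for x
      using that by (intro R) simp
    have uniq: "x = y" if "x \<in> PiE {..n} (\<lambda>_. reach E v N)" "\<forall>i\<le>n. X (k + i) \<omega> = x i" for x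
      using that y by (intro PiE_ext[OF that(1) y(1)]) auto
    show ?case
    proof (intro conjI ballI impI)
      fix x assume "x \<in> {x. x \<in> PiE {..n} (\<lambda>_. reach E v N) \<and> R x}" "S \<omega> \<and> (\<forall>i\<le>n. X (k + i) \<omega> = x i)"
      then show "S \<omega>" "R (\<lambda>i. X (k + i) \<omega>)" using R'[of x] by blast+
    next
      assume h: "S \<omega> \<and> R (\<lambda>i. X (k + i) \<omega>)"
      show "\<exists>!x\<in>{x. x \<in> PiE {..n} (\<lambda>_. reach E v N) \<and> R x}. S \<omega> \<and> (\<forall>i\<le>n. X (k + i) \<omega> = x i)"
      proof (rule ex1I[of _ y])
        show "y \<in> {x. x \<in> PiE {..n} (\<lambda>_. reach E v N) \<and> R x} \<and> S \<omega> \<and> (\<forall>i\<le>n. X (k + i) \<omega> = y i)"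
          using h y R'[OF y(2)] by blast
      qed (use uniq in blast)
    qed
  qed
qed measurable

lemma history_sum:
  assumes R: "\<And>x x'. (\<And>i. i \<le> n \<Longrightarrow> x i = x' i) \<Longrightarrow> R x = R x'"
    and mR: "Measurable.pred M (\<lambda>\<omega>. R (\<lambda>i. X i \<omega>))" and N: "n \<le> N"
  shows "\<P>(\<omega> in M. R (\<lambda>i. X i \<omega>)) = (\<Sum>x | x \<in> PiE {..n} (\<lambda>_. reach E v N) \<and> R x. H n x)"
proof -
  have "\<P>(\<omega> in M. True \<and> R (\<lambda>i. X (0 + i) \<omega>)) =
    (\<Sum>x | x \<in> PiE {..n} (\<lambda>_. reach E v N) \<and> R x. \<P>(\<omega> in M. True \<and> (\<forall>i\<le>n. X (0 + i) \<omega> = x i)))"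
    by (rule history_decomposition[OF R]) (simp_all add: mR N)
  then show ?thesis unfolding H_def by simp
qed

lemma position_sum:
  "\<P>(\<omega> in M. X n \<omega> = a) = (\<Sum>x | x \<in> PiE {..n} (\<lambda>_. reach E v n) \<and> x n = a. H n x)"
  by (rule history_sum[where R = "\<lambda>x. x n = a"]) simp_all

text \<open>Past and future are both decomposed into paths; \<open>history_restart\<close>
  factorises each pair, and the double sum becomes a product of two sums.\<close>

lemma renewal_at_start:
  assumes Q: "depends_upto n Q" and C: "depends_upto m C"
  shows "\<P>(\<omega> in M. Q (\<lambda>t. X t \<omega> = v) \<and> X n \<omega> = v \<and> C (\<lambda>i. X (n + i) \<omega> = v)) =
    \<P>(\<omega> in M. Q (\<lambda>t. X t \<omega> = v) \<and> X n \<omega> = v) * \<P>(\<omega> in M. C (\<lambda>t. X t \<omega> = v))"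
proof -
  define QQ where "QQ x \<longleftrightarrow> Q (\<lambda>t. x t = v) \<and> x n = v" for x
  define CC where "CC x \<longleftrightarrow> C (\<lambda>t. x t = v)" for x
  have QQ: "QQ x = QQ x'" if "\<And>i. i \<le> n \<Longrightarrow> x i = x' i" for x x'
    using depends_uptoD[OF Q, of "\<lambda>t. x t = v" "\<lambda>t. x' t = v"] that by (simp add: QQ_def)
  have CC: "CC x = CC x'" if "\<And>i. i \<le> m \<Longrightarrow> x i = x' i" for x x'
    using depends_uptoD[OF C, of "\<lambda>t. x t = v" "\<lambda>t. x' t = v"] that by (simp add: CC_def)
  have mC: "Measurable.pred M (\<lambda>\<omega>. CC (\<lambda>i. X (k + i) \<omega>))" for k
    unfolding CC_def by (rule measurable_depends_upto[OF _ C]) (rule X_pred(1))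
  have mQ: "Measurable.pred M (\<lambda>\<omega>. QQ (\<lambda>i. X i \<omega>))"
    unfolding QQ_def using measurable_depends_upto[OF X_pred(1) Q] by simp
  define FQ where "FQ = {x. x \<in> PiE {..n} (\<lambda>_. reach E v (n + m)) \<and> QQ x}"
  define FC where "FC = {x. x \<in> PiE {..m} (\<lambda>_. reach E v (n + m)) \<and> CC x}"
  have "\<P>(\<omega> in M. CC (\<lambda>i. X (n + i) \<omega>) \<and> QQ (\<lambda>i. X (0 + i) \<omega>)) =
    (\<Sum>x\<in>FQ. \<P>(\<omega> in M. CC (\<lambda>i. X (n + i) \<omega>) \<and> (\<forall>i\<le>n. X (0 + i) \<omega> = x i)))"
    unfolding FQ_def by (rule history_decomposition[OF QQ _ mC]) (simp_all add: mQ)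
  also have "\<dots> = (\<Sum>x\<in>FQ. H n x * (\<Sum>c\<in>FC. H m c))"
  proof (rule sum.cong[OF refl])
    fix x assume x: "x \<in> FQ"
    have "\<P>(\<omega> in M. CC (\<lambda>i. X (n + i) \<omega>) \<and> (\<forall>i\<le>n. X (0 + i) \<omega> = x i)) =
      \<P>(\<omega> in M. (\<forall>i\<le>n. X i \<omega> = x i) \<and> CC (\<lambda>i. X (n + i) \<omega>))"
      by (simp add: conj_commute)
    also have "\<dots> = (\<Sum>c\<in>FC. \<P>(\<omega> in M. (\<forall>i\<le>n. X i \<omega> = x i) \<and> (\<forall>i\<le>m. X (n + i) \<omega> = c i)))"
      unfolding FC_def by (rule history_decomposition[OF CC mC]) simp_all
    also have "\<dots> = (\<Sum>c\<in>FC. H n x * H m c)"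
      using x by (intro sum.cong refl history_restart) (simp add: FQ_def QQ_def)
    finally show "\<P>(\<omega> in M. CC (\<lambda>i. X (n + i) \<omega>) \<and> (\<forall>i\<le>n. X (0 + i) \<omega> = x i)) = H n x * (\<Sum>c\<in>FC. H m c)"
      by (simp only: sum_distrib_left)
  qed
  also have "\<dots> = (\<Sum>x\<in>FQ. H n x) * (\<Sum>c\<in>FC. H m c)" by (simp only: sum_distrib_right)
  also have "(\<Sum>x\<in>FQ. H n x) = \<P>(\<omega> in M. QQ (\<lambda>i. X i \<omega>))"
    unfolding FQ_def by (rule history_sum[OF QQ mQ, symmetric]) simp_all
  also have "(\<Sum>c\<in>FC. H m c) = \<P>(\<omega> in M. CC (\<lambda>i. X i \<omega>))"
    unfolding FC_def using mC[of 0] by (intro history_sum[OF CC, symmetric]) simp_all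
  finally show ?thesis
    by (simp add: QQ_def CC_def conj_ac)
qed

text \<open>The forward equation of the chain: summing over the previous position gives a sum over
  the vertices that lead to \<open>b\<close>, and symmetry of \<open>E\<close> makes these the
  neighbours of \<open>b\<close>.\<close>

lemma position_step:
  assumes "b \<in> V"
  shows "\<P>(\<omega> in M. X (Suc n) \<omega> = b) = (\<Sum>a\<in>E `` {b}. \<P>(\<omega> in M. X n \<omega> = a) / real (card (E `` {a})))"
proof -
  let ?q = "\<lambda>a. \<P>(\<omega> in M. X n \<omega> = a)"
  have two: "\<P>(\<omega> in M. X (Suc n) \<omega> = b \<and> X n \<omega> = a) = ?q a * p a b" for a
  proof -
    have "\<P>(\<omega> in M. X (Suc n) \<omega> = b \<and> X (0 + n) \<omega> = a) =
      (\<Sum>x | x \<in> PiE {..n} (\<lambda>_. reach E v n) \<and> x n = a. \<P>(\<omega> in M. X (Suc n) \<omega> = b \<and> (\<forall>i\<le>n. X (0 + i) \<omega> = x i)))"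
      by (rule history_decomposition[where R = "\<lambda>x. x n = a"]) simp_all
    also have "\<dots> = (\<Sum>x | x \<in> PiE {..n} (\<lambda>_. reach E v n) \<and> x n = a. H n x * p a b)"
      by (rule sum.cong[OF refl], subst conj_commute) (auto simp: history_step)
    also have "\<dots> = (\<Sum>x | x \<in> PiE {..n} (\<lambda>_. reach E v n) \<and> x n = a. H n x) * p a b"
      by (simp only: sum_distrib_right)
    also have "(\<Sum>x | x \<in> PiE {..n} (\<lambda>_. reach E v n) \<and> x n = a. H n x) = ?q a"
      by (rule position_sum[symmetric])
    finally show ?thesis by simp
  qed
  have out: "?q a = 0" if "a \<notin> reach E v n" for a
  proof -
    have "AE \<omega> in M. X n \<omega> \<noteq> a" using AE_reach[of n] by eventually_elim (use that in auto)
    then show ?thesis using prob_Collect_eq_0[OF predE[OF X_pred(1)]] by blast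
  qed
  have "\<P>(\<omega> in M. X (Suc n) \<omega> = b) = (\<Sum>a\<in>reach E v n. \<P>(\<omega> in M. X (Suc n) \<omega> = b \<and> X n \<omega> = a))"
  proof (rule prob_sum)
    show "AE \<omega> in M. (\<forall>a\<in>reach E v n. X (Suc n) \<omega> = b \<and> X n \<omega> = a \<longrightarrow> X (Suc n) \<omega> = b) \<and>
      (X (Suc n) \<omega> = b \<longrightarrow> (\<exists>!a\<in>reach E v n. X (Suc n) \<omega> = b \<and> X n \<omega> = a))"
      using AE_reach[of n] by eventually_elim auto
  qed (auto simp: finite_reach)
  also have "\<dots> = (\<Sum>a\<in>reach E v n. ?q a * p a b)" by (simp only: two)
  also have "\<dots> = (\<Sum>a\<in>reach E v n \<inter> E `` {b}. ?q a / real (card (E `` {a})))"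
  proof (rule sum.mono_neutral_cong_right)
    have pb: "p a b = of_bool (a \<in> E `` {b}) / real (card (E `` {a}))" if "a \<in> reach E v n" for a
    proof -
      have "a \<in> V" using that reach_V by blast
      moreover have "(a, b) \<in> E \<longleftrightarrow> (b, a) \<in> E" using symE by (blast dest: symD)
      ultimately show ?thesis by (simp add: p_eq)
    qed
    show "\<forall>a\<in>reach E v n - reach E v n \<inter> E `` {b}. ?q a * p a b = 0"
      by (simp add: pb)
    show "?q a * p a b = ?q a / real (card (E `` {a}))" if "a \<in> reach E v n \<inter> E `` {b}" for a
      using that by (simp add: pb)
  qed (auto simp: finite_reach)
  also have "\<dots> = (\<Sum>a\<in>E `` {b}. ?q a / real (card (E `` {a})))"
    using finite_nbrs[OF assms] out by (intro sum.mono_neutral_left) auto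
  finally show ?thesis .
qed

lemma return_probability_tendsto_0: "(\<lambda>t. \<P>(\<omega> in M. X t \<omega> = v)) \<longlonglongrightarrow> 0"
proof (rule heat_kernel_tendsto_0[OF simple inf con lf v, where q = "\<lambda>t a. \<P>(\<omega> in M. X t \<omega> = a)"])
  have sub: "{a. \<P>(\<omega> in M. X n \<omega> = a) \<noteq> 0} \<subseteq> reach E v n" for n
  proof (rule subsetI, rule ccontr)
    fix a assume a: "a \<in> {a. \<P>(\<omega> in M. X n \<omega> = a) \<noteq> 0}" "a \<notin> reach E v n"
    have "AE \<omega> in M. X n \<omega> \<noteq> a" using AE_reach[of n] by eventually_elim (use a in auto)
    then have "\<P>(\<omega> in M. X n \<omega> = a) = 0"
      using prob_Collect_eq_0[OF predE[OF X_pred(1)]] by blast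
    then show False using a by simp
  qed
  show "finite {a. \<P>(\<omega> in M. X n \<omega> = a) \<noteq> 0}" for n
    by (rule finite_subset[OF sub finite_reach])
  show "a \<in> V" if "\<P>(\<omega> in M. X n \<omega> = a) \<noteq> 0" for n a
    using that sub[of n] reach_V[of n] by blast
  show "(\<Sum>a\<in>S. \<P>(\<omega> in M. X n \<omega> = a)) \<le> 1" if "finite S" for n S
  proof -
    have "\<P>(\<omega> in M. X n \<omega> \<in> S) = (\<Sum>a\<in>S. \<P>(\<omega> in M. X n \<omega> = a))"
      using that by (intro prob_sum) auto
    then show ?thesis using prob_le_1[of "{\<omega>\<in>space M. X n \<omega> \<in> S}"] by linarith
  qed
  show "\<P>(\<omega> in M. X (Suc n) \<omega> = b) = (\<Sum>a\<in>E `` {b}. \<P>(\<omega> in M. X n \<omega> = a) / real (card (E `` {a})))"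
    if "b \<in> V" for n b by (rule position_step[OF that])
qed simp

lemma returns_renewal:
  assumes "recurrent_graph V E"
  shows "renewal_process M (\<lambda>t \<omega>. X t \<omega> = v)"
proof unfold_locales
  show "AE \<omega> in M. X 0 \<omega> = v" by (rule X_0)
  show "(\<lambda>t. \<P>(\<omega> in M. X t \<omega> = v)) \<longlonglongrightarrow> 0" by (rule return_probability_tendsto_0)
  show "AE \<omega> in M. \<exists>t>0. X t \<omega> = v" by (rule recurrent_graph_returns[OF assms v walk])
qed (auto intro: renewal_at_start)

end

section \<open>Application to the walks of the theorem\<close>

text \<open>The recursion for \<open>H\<close> involves only the graph and the starting vertex. This
  gives the two walks on the first graph equal return probabilities.\<close>

lemma position_law_unique:
  assumes "random_walk M V E v X" "random_walk M' V E v X'"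
  shows "\<P>(\<omega> in M. X t \<omega> = a) = \<P>(\<omega> in M'. X' t \<omega> = a)"
proof -
  interpret A: random_walk M V E v X by fact
  interpret B: random_walk M' V E v X' by fact
  have "A.H n x = B.H n x" for n x
    by (induction n) (simp_all add: A.H_0 B.H_0 A.H_Suc B.H_Suc A.p_def B.p_def)
  then show ?thesis by (simp add: A.position_sum B.position_sum)
qed

text \<open>A finite-horizon event of the returns is the preimage of a measurable set of paths, so
  independence of the path-valued variables applies directly.\<close>

lemma indep_walks_indep_returns:
  assumes M: "prob_space M" and indep: "prob_space.indep_var M (seq_space V) (\<lambda>\<omega> t. X t \<omega>) (seq_space V) (\<lambda>\<omega> t. Y t \<omega>)"
  shows "indep_processes M (\<lambda>t \<omega>. X t \<omega> = a) (\<lambda>t \<omega>. Y t \<omega> = a)"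
  unfolding indep_processes_def
proof (intro allI impI)
  interpret prob_space M by fact
  fix n Q R assume Q: "depends_upto n Q" and R: "depends_upto n R"
  let ?S = "seq_space V"
  have [measurable]: "(\<lambda>\<omega> t. X t \<omega>) \<in> measurable M ?S" "(\<lambda>\<omega> t. Y t \<omega>) \<in> measurable M ?S"
    using indep_var_rv1[OF indep] indep_var_rv2[OF indep] by auto
  have pre: "Measurable.pred ?S (\<lambda>s. s t = a)" for t
  proof -
    have "(\<lambda>s. s t) \<in> measurable ?S (count_space V)" by (rule measurable_component_singleton) simp
    then show ?thesis by (rule measurable_compose) simp
  qed
  have ev: "{s \<in> space ?S. B (\<lambda>t. s t = a)} \<in> sets ?S" if "depends_upto n B" for B
    using measurable_depends_upto[OF pre that] by simp
  have inv: "(\<lambda>\<omega> t. Z t \<omega>) -` {s \<in> space ?S. B (\<lambda>t. s t = a)} \<inter> space M = {\<omega>\<in>space M. B (\<lambda>t. Z t \<omega> = a)}"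
    if "(\<lambda>\<omega> t. Z t \<omega>) \<in> measurable M ?S" for Z B
    using measurable_space[OF that] by auto
  have "{\<omega>\<in>space M. Q (\<lambda>t. X t \<omega> = a) \<and> R (\<lambda>t. Y t \<omega> = a)} =
    (\<lambda>\<omega>. (\<lambda>t. X t \<omega>, \<lambda>t. Y t \<omega>)) -` ({s \<in> space ?S. Q (\<lambda>t. s t = a)} \<times> {s \<in> space ?S. R (\<lambda>t. s t = a)}) \<inter> space M"
    using inv[of X Q] inv[of Y R] by auto
  then show "\<P>(\<omega> in M. Q (\<lambda>t. X t \<omega> = a) \<and> R (\<lambda>t. Y t \<omega> = a)) =
    \<P>(\<omega> in M. Q (\<lambda>t. X t \<omega> = a)) * \<P>(\<omega> in M. R (\<lambda>t. Y t \<omega> = a))"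
    using indep_varD[OF indep ev[OF Q] ev[OF R]] inv[of X Q] inv[of Y R] by simp
qed

theorem mainTheorem2:
  fixes V1 :: "'a set" and E1 :: "('a \<times> 'a) set" and o1 :: 'a
    and V2 :: "'b set" and E2 :: "('b \<times> 'b) set" and o2 :: 'b
    and M1 :: "'w1 measure" and X X' :: "nat \<Rightarrow> 'w1 \<Rightarrow> 'a"
    and M2 :: "'w2 measure" and W :: "nat \<Rightarrow> 'w2 \<Rightarrow> 'b"
    and \<mu> \<nu> :: "(nat \<Rightarrow> nat) measure"
  assumes G1: "simple_graph V1 E1" "infinite V1" "connected_graph V1 E1"
      "locally_finite_graph V1 E1" "recurrent_graph V1 E1"
    and G2: "simple_graph V2 E2" "infinite V2" "connected_graph V2 E2"
      "locally_finite_graph V2 E2" "recurrent_graph V2 E2"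
    and o1: "o1 \<in> V1" and o2: "o2 \<in> V2"
    and X: "simple_random_walk V1 E1 o1 M1 X"
    and X': "simple_random_walk V1 E1 o1 M1 X'"
    and indep: "prob_space.indep_var M1
      (seq_space V1) (\<lambda>\<omega> t. X t \<omega>) (seq_space V1) (\<lambda>\<omega> t. X' t \<omega>)"
    and W: "simple_random_walk V2 E2 o2 M2 W"
    and \<mu>: "\<mu> = distr M1 (seq_space {0, 1})
      (\<lambda>\<omega> t. of_bool (X t \<omega> = o1 \<or> X' t \<omega> = o1))"
    and \<nu>: "\<nu> = distr M2 (seq_space {0, 1}) (\<lambda>\<omega> t. of_bool (W t \<omega> = o2))"
  shows "\<not> absolutely_continuous \<nu> \<mu>"
proof -
  have M1: "prob_space M1" and M2: "prob_space M2"
    using X W by (simp_all add: simple_random_walk_def)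
  have RX: "random_walk M1 V1 E1 o1 X" and RX': "random_walk M1 V1 E1 o1 X'" and RW: "random_walk M2 V2 E2 o2 W"
    using M1 M2 G1 G2 o1 o2 X X' W by (simp_all add: random_walk_def random_walk_axioms_def)
  show ?thesis
  proof (rule renewal_union_not_absolutely_continuous)
    show "renewal_process M1 (\<lambda>t \<omega>. X t \<omega> = o1)"
      by (rule random_walk.returns_renewal[OF RX G1(5)])
    show "renewal_process M1 (\<lambda>t \<omega>. X' t \<omega> = o1)"
      by (rule random_walk.returns_renewal[OF RX' G1(5)])
    show "renewal_process M2 (\<lambda>t \<omega>. W t \<omega> = o2)"
      by (rule random_walk.returns_renewal[OF RW G2(5)])
    show "indep_processes M1 (\<lambda>t \<omega>. X t \<omega> = o1) (\<lambda>t \<omega>. X' t \<omega> = o1)"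
      by (rule indep_walks_indep_returns[OF M1 indep])
    show "\<P>(\<omega> in M1. X t \<omega> = o1) = \<P>(\<omega> in M1. X' t \<omega> = o1)" for t
      by (rule position_law_unique[OF RX RX'])
  qed (fact \<mu> \<nu>)+
qed

end
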